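(* Let $(\mathcal{C},\mathcal{D})$ be a $C^*$-diagonal with conditional expectation $E:\mathcal{C}\to\mathcal{D}$. If $\mathcal{A}$ is a triangular subalgebra of $(\mathcal{C},\mathcal{D})$, then $E|_{\mathcal{A}}$ is a homomorphism of $\mathcal{A}$ onto $\mathcal{D}$.
   Context: Let $\mathcal{C}$ be a unital $C^*$-algebra and $\mathcal{D}\subseteq\mathcal{C}$ an abelian $C^*$-subalgebra containing the unit. $\mathcal{N}(\mathcal{C})=\{v\in\mathcal{C}:v\mathcal{D}v^*\cup v^*\mathcal{D}v\subseteq\mathcal{D}\}$ is the set of normalizers. $\mathcal{D}$ has the extension property in $\mathcal{C}$ if every pure state of $\mathcal{D}$ has a unique extension to a state of $\mathcal{C}$ and no pure state of $\mathcal{C}$ annihilates $\mathcal{D}$. $(\mathcal{C},\mathcal{D})$ is a $C^*$-diagonal if $\mathcal{D}$ is a maximal abelian $C^*$-subalgebra of the unital $C^*$-algebra $\mathcal{C}$ with the extension property, the closed linear span of $\mathcal{N}(\mathcal{C})$ is $\mathcal{C}$, and the unique conditional expectation $E:\mathcal{C}\to\mathcal{D}$ is faithful. A triangular subalgebra of $(\mathcal{C},\mathcal{D})$ is a norm-closed subalgebra $\mathcal{A}$ with $\mathcal{D}\subseteq\mathcal{A}\subseteq\mathcal{C}$ and $\mathcal{A}\cap\mathcal{A}^*=\mathcal{D}$. *)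

theory Defs
  imports "HOL-Analysis.Analysis"
begin

section \<open>Unital C*-algebras\<close>

text \<open>Completeness and the submultiplicative norm are inherited; the complex scalar
  multiplication is required to extend the real one. As usual the algebra is nonzero.\<close>

class cstar_algebra = real_normed_algebra_1 + banach +
  fixes scaleC :: "complex \<Rightarrow> 'a \<Rightarrow> 'a" (infixr \<open>*\<^sub>C\<close> 75)
    and star :: "'a \<Rightarrow> 'a"
  assumes scaleR_scaleC: "r *\<^sub>R x = complex_of_real r *\<^sub>C x"
    and scaleC_add_right: "c *\<^sub>C (x + y) = c *\<^sub>C x + c *\<^sub>C y"
    and scaleC_add_left: "(c + d) *\<^sub>C x = c *\<^sub>C x + d *\<^sub>C x"
    and scaleC_scaleC: "c *\<^sub>C d *\<^sub>C x = (c * d) *\<^sub>C x"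
    and mult_scaleC_left: "(c *\<^sub>C x) * y = c *\<^sub>C (x * y)"
    and mult_scaleC_right: "x * (c *\<^sub>C y) = c *\<^sub>C (x * y)"
    and norm_scaleC: "norm (c *\<^sub>C x) = cmod c * norm x"
    and star_star: "star (star x) = x"
    and star_add: "star (x + y) = star x + star y"
    and star_scaleC: "star (c *\<^sub>C x) = cnj c *\<^sub>C star x"
    and star_mult: "star (x * y) = star y * star x"
    and norm_star_mult_self: "norm (star x * x) = (norm x)\<^sup>2"

lemma scaleC_one: "1 *\<^sub>C x = (x :: 'a :: cstar_algebra)"
  using scaleR_scaleC[of 1 x] by simp

global_interpretation complex_vector:
  vector_space "scaleC :: complex \<Rightarrow> 'a \<Rightarrow> 'a :: cstar_algebra"
  defines csubspace = complex_vector.subspace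
    and cspan = complex_vector.span
  by unfold_locales
    (simp_all add: scaleC_add_right scaleC_add_left scaleC_scaleC scaleC_one)

instantiation complex :: cstar_algebra
begin

definition scaleC_complex :: "complex \<Rightarrow> complex \<Rightarrow> complex" where
  "scaleC_complex c z = c * z"

definition star_complex :: "complex \<Rightarrow> complex" where
  "star_complex z = cnj z"

instance
  by standard
    (simp_all add: scaleC_complex_def star_complex_def scaleR_conv_of_real algebra_simps
      norm_mult power2_eq_square)

end

section \<open>Subalgebras and homomorphisms\<close>

definition closed_subalgebra :: "'a :: cstar_algebra set \<Rightarrow> bool" where
  "closed_subalgebra A \<longleftrightarrow>
     csubspace A \<and> closed A \<and> (\<forall>x\<in>A. \<forall>y\<in>A. x * y \<in> A)"

definition cstar_subalgebra :: "'a :: cstar_algebra set \<Rightarrow> bool" where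
  "cstar_subalgebra B \<longleftrightarrow> closed_subalgebra B \<and> (\<forall>x\<in>B. star x \<in> B)"

definition abelian_cstar_subalgebra :: "'a :: cstar_algebra set \<Rightarrow> bool" where
  "abelian_cstar_subalgebra B \<longleftrightarrow>
     cstar_subalgebra B \<and> (\<forall>x\<in>B. \<forall>y\<in>B. x * y = y * x)"

definition maximal_abelian_cstar_subalgebra :: "'a :: cstar_algebra set \<Rightarrow> bool" where
  "maximal_abelian_cstar_subalgebra D \<longleftrightarrow>
     abelian_cstar_subalgebra D \<and>
     (\<forall>B. abelian_cstar_subalgebra B \<and> D \<subseteq> B \<longrightarrow> B = D)"

definition clinear_on :: "'a set \<Rightarrow> ('a :: cstar_algebra \<Rightarrow> 'b :: cstar_algebra) \<Rightarrow> bool" where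
  "clinear_on B f \<longleftrightarrow>
     (\<forall>x\<in>B. \<forall>y\<in>B. f (x + y) = f x + f y) \<and> (\<forall>c. \<forall>x\<in>B. f (c *\<^sub>C x) = c *\<^sub>C f x)"

definition algebra_hom_on :: "'a set \<Rightarrow> ('a :: cstar_algebra \<Rightarrow> 'b :: cstar_algebra) \<Rightarrow> bool" where
  "algebra_hom_on A f \<longleftrightarrow> clinear_on A f \<and> (\<forall>x\<in>A. \<forall>y\<in>A. f (x * y) = f x * f y)"

section \<open>States and the extension property\<close>

text \<open>A functional on a C*-subalgebra B (containing the unit) is a total function of which only
  the values on B matter; functionals on B are therefore compared on B only. In particular
  states of the whole algebra are those on UNIV.\<close>

definition state_on :: "'a :: cstar_algebra set \<Rightarrow> ('a \<Rightarrow> complex) \<Rightarrow> bool" where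
  "state_on B f \<longleftrightarrow>
     clinear_on B f \<and> (\<forall>x\<in>B. f (star x * x) \<in> \<real>\<^sub>\<ge>\<^sub>0) \<and> f 1 = 1"

text \<open>Pure states are the extreme points of the state space.\<close>

definition pure_state_on :: "'a :: cstar_algebra set \<Rightarrow> ('a \<Rightarrow> complex) \<Rightarrow> bool" where
  "pure_state_on B f \<longleftrightarrow>
     state_on B f \<and>
     (\<forall>g h t. state_on B g \<and> state_on B h \<and> 0 < t \<and> t < 1 \<and>
        (\<forall>x\<in>B. f x = complex_of_real t * g x + complex_of_real (1 - t) * h x) \<longrightarrow>
        (\<forall>x\<in>B. g x = f x \<and> h x = f x))"

definition extension_property :: "'a :: cstar_algebra set \<Rightarrow> bool" where
  "extension_property D \<longleftrightarrow>
     (\<forall>f. pure_state_on D f \<longrightarrow> (\<exists>!g. state_on UNIV g \<and> (\<forall>x\<in>D. g x = f x))) \<and>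
     \<not> (\<exists>g. pure_state_on UNIV g \<and> (\<forall>x\<in>D. g x = 0))"

section \<open>Conditional expectations\<close>

text \<open>Positivity of an element of D is expressed as being of the form d* d with d in D.
  Complete positivity is not listed since it follows from positivity and the bimodule
  property.\<close>

definition conditional_expectation :: "'a :: cstar_algebra set \<Rightarrow> ('a \<Rightarrow> 'a) \<Rightarrow> bool" where
  "conditional_expectation D E \<longleftrightarrow>
     clinear_on UNIV E \<and>
     range E \<subseteq> D \<and>
     (\<forall>d\<in>D. E d = d) \<and>
     (\<forall>x. \<forall>d\<in>D. E (d * x) = d * E x \<and> E (x * d) = E x * d) \<and>
     (\<forall>x. \<exists>d\<in>D. E (star x * x) = star d * d) \<and>
     (\<forall>x. norm (E x) \<le> norm x)"

definition faithful :: "('a :: cstar_algebra \<Rightarrow> 'a) \<Rightarrow> bool" where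
  "faithful E \<longleftrightarrow> (\<forall>x. E (star x * x) = 0 \<longrightarrow> x = 0)"

section \<open>C*-diagonals and triangular subalgebras\<close>

text \<open>In the following definitions the ambient algebra is the whole type.\<close>

definition normalizers :: "'a :: cstar_algebra set \<Rightarrow> 'a set" where
  "normalizers D = {v. \<forall>d\<in>D. v * d * star v \<in> D \<and> star v * d * v \<in> D}"

definition cstar_diagonal :: "'a :: cstar_algebra set \<Rightarrow> bool" where
  "cstar_diagonal D \<longleftrightarrow>
     1 \<in> D \<and>
     maximal_abelian_cstar_subalgebra D \<and>
     extension_property D \<and>
     closure (cspan (normalizers D)) = UNIV \<and>
     (\<exists>!E. conditional_expectation D E) \<and>
     (\<forall>E. conditional_expectation D E \<longrightarrow> faithful E)"

definition triangular_subalgebra :: "'a :: cstar_algebra set \<Rightarrow> 'a set \<Rightarrow> bool" where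
  "triangular_subalgebra D A \<longleftrightarrow>
     closed_subalgebra A \<and> D \<subseteq> A \<and> A \<inter> star ` A = D"

end

theory Submission
  imports Defs
begin

text \<open>Since \<open>E\<close> is linear and \<open>D\<close>-bimodular, multiplicativity on \<open>A\<close> reduces to \<open>E (a * b) = 0\<close>
for \<open>a, b \<in> A\<close> with \<open>E b = 0\<close>. Elements of \<open>D\<close> are separated by the characters \<open>\<rho>\<close> of \<open>D\<close>, so
fix one and put \<open>\<phi> x = \<rho> (E x)\<close>. This is a state of the whole algebra, and by the extension property
the only one that extends \<open>\<rho>\<close>. Read \<open>\<langle>x, y\<rangle> = \<phi> (star x * y)\<close> as a semi-inner product; the goal is
that \<open>star a\<close> and \<open>b\<close> are orthogonal. Because the span of the normalizers is dense, \<open>b\<close> is a limit of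
combinations of normalizers, and the proof is a Parseval argument with the normalizers in the role of
an orthogonal basis. Two facts make it work.

\<^item> For every normalizer \<open>v\<close> one of the coefficients \<open>\<langle>v, b\<rangle>\<close> and \<open>\<langle>star a, v\<rangle>\<close> vanishes
  (\<open>triangular_coefficients\<close>). The piece \<open>v * E (star v * b)\<close> of \<open>b\<close> lies in \<open>A\<close>, and so
  does \<open>E (a * v) * star v\<close>. Multiplying the first by the adjoint of \<open>E (a * v)\<close> gives an element \<open>X\<close>
  with \<open>X\<close> and \<open>star X\<close> in \<open>A\<close>, hence in \<open>D\<close> by triangularity; then \<open>X = E X\<close>, and \<open>E X = 0\<close>
  because \<open>E b = 0\<close>.
\<^item> If \<open>v\<close> and \<open>w\<close> are not orthogonal, then everything orthogonal to \<open>v\<close> is orthogonal to \<open>w\<close>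
  (\<open>orthogonality_transfer\<close>): the vectors are proportional. Indeed \<open>u = star v * w\<close> then fixes \<open>\<rho>\<close>, and
  uniqueness of the extension, applied to the vector states of \<open>1 + c *\<^sub>C (u - E u)\<close>, forces the
  vector \<open>u - E u\<close> to be zero (\<open>fixing_normalizer\<close>).

Membership of \<open>v * E (star v * b)\<close> in the closed bimodule \<open>A\<close> rests on the approximation of \<open>E x\<close> in
norm by averages \<open>\<Sum>i. h i * x * h i\<close> with \<open>h i \<in> D\<close> (\<open>E_approximation\<close>). It is obtained
in two steps. If \<open>x\<close> is self-adjoint with \<open>E x = 0\<close>, then for each character \<open>\<rho>\<close> there is a
majorant \<open>d \<ge> x\<close> in \<open>D\<close> with \<open>\<rho> d\<close> small, for otherwise a Hahn-Banach argument extends \<open>\<rho>\<close> to a state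
different from \<open>\<phi>\<close> (\<open>state_extension\<close>). A partition of unity in \<open>D\<close> then combines finitely many of these
majorants (\<open>partition_of_unity\<close>); compactness of the character space enters in the form of a
Positivstellensatz (\<open>character_exists\<close>).

The C*-algebraic foundation is the order structure: every \<open>star x * x\<close> is positive
(\<open>positive_star_mult_self\<close>) and order bounds are norm bounds (\<open>norm_le_of_positive\<close>). Both are derived
without spectra, from square roots obtained by iteration. Functionals, in turn, are
read off as Dedekind cuts with respect to cones that are maximal by Zorn's lemma.\<close>

section \<open>Involution and closed subalgebras\<close>

lemma star_zero [simp]: "star (0::'a::cstar_algebra) = 0"
  using star_add[of "0::'a" 0] by simp

lemma star_minus [simp]: "star (- x) = - star (x::'a::cstar_algebra)"
proof -
  have "star (- x) + star x = 0" using star_add[of "-x" x] by simp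
  thus ?thesis by (simp add: eq_neg_iff_add_eq_0)
qed

lemma star_diff: "star (x - y) = star x - star (y::'a::cstar_algebra)"
  using star_add[of x "-y"] by simp

lemma star_one [simp]: "star (1::'a::cstar_algebra) = 1"
  using star_mult[of "star (1::'a)" 1] by (simp add: star_star)

lemma star_scaleR: "star (r *\<^sub>R x) = r *\<^sub>R star (x::'a::cstar_algebra)"
  by (simp add: scaleR_scaleC star_scaleC)

lemma star_of_real [simp]: "star (of_real r :: 'a::cstar_algebra) = of_real r"
  by (simp add: of_real_def star_scaleR)

lemma norm_star [simp]: "norm (star x) = norm (x::'a::cstar_algebra)"
proof -
  have le: "norm y \<le> norm (star y)" for y :: 'a
  proof (cases "y = 0")
    case False
    have "norm y * norm y \<le> norm (star y) * norm y"
      using norm_star_mult_self[of y] norm_mult_ineq[of "star y" y] by (simp add: power2_eq_square)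
    with False show ?thesis by simp
  qed simp
  from le[of x] le[of "star x"] show ?thesis by (simp add: star_star)
qed

lemma bounded_linear_star: "bounded_linear (star :: 'a::cstar_algebra \<Rightarrow> 'a)"
  by (rule bounded_linear_intro[where K = 1]) (auto simp: star_add star_scaleR)

lemmas tendsto_star = bounded_linear.tendsto[OF bounded_linear_star]
lemma norm_square_self_adjoint: "star y = y \<Longrightarrow> norm (y * y) = (norm (y::'a::cstar_algebra))\<^sup>2"
  using norm_star_mult_self[of y] by simp

lemma of_real_commute: "of_real r * x = x * (of_real r :: 'a::real_algebra_1)"
  by (simp add: of_real_def)

text \<open>Linearity is required over the reals only. The construction of square roots and inverses uses nothing more, and
stating that they lie in every such set containing the given element yields at one stroke membership in C*-subalgebras and,
through commutants, commutation properties.\<close>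

definition closed_unital_subalgebra :: "'a::real_normed_algebra_1 set \<Rightarrow> bool" where
  "closed_unital_subalgebra B \<longleftrightarrow>
     closed B \<and> subspace B \<and> 1 \<in> B \<and> (\<forall>x\<in>B. \<forall>y\<in>B. x * y \<in> B)"

lemma closed_unital_subalgebra_commutant:
  "closed_unital_subalgebra {z. z * c = c * (z::'a::real_normed_algebra_1)}"
  unfolding closed_unital_subalgebra_def
proof (intro conjI ballI)
  show "closed {z. z * c = c * z}" by (intro closed_Collect_eq continuous_intros)
  show "subspace {z. z * c = c * z}" by (auto simp: subspace_def algebra_simps)
  fix x y assume "x \<in> {z. z * c = c * z}" "y \<in> {z. z * c = c * z}"
  thus "x * y \<in> {z. z * c = c * z}" by (simp) (metis mult.assoc)
qed simp

section \<open>Square roots by iteration\<close>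

text \<open>The fixed points \<open>s\<close> of this iteration satisfy \<open>(1 - s)\<^sup>2 = 1 - x\<close>. All its terms
are polynomials in \<open>x\<close> with nonnegative coefficients, so the scalar iteration at \<open>x = 1\<close> dominates
it, increments included.\<close>

primrec sqrt_iter :: "'a::real_normed_algebra_1 \<Rightarrow> nat \<Rightarrow> 'a" where
  "sqrt_iter x 0 = 0"
| "sqrt_iter x (Suc n) = (1/2) *\<^sub>R (x + sqrt_iter x n * sqrt_iter x n)"

lemma sqrt_iter_real_bounds:
  "0 \<le> sqrt_iter (1::real) n" "sqrt_iter (1::real) n \<le> 1"
  "sqrt_iter (1::real) n \<le> sqrt_iter 1 (Suc n)"
proof -
  show *: "0 \<le> sqrt_iter (1::real) n" for n by (induction n) auto
  show "sqrt_iter (1::real) n \<le> 1" for n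
  proof (induction n)
    case (Suc n)
    have "sqrt_iter (1::real) n * sqrt_iter 1 n \<le> 1" using Suc *[of n] by (simp add: mult_le_one)
    thus ?case by simp
  qed simp
  show "sqrt_iter (1::real) n \<le> sqrt_iter 1 (Suc n)"
    using zero_le_square[of "sqrt_iter (1::real) n - 1"] by (simp add: algebra_simps)
qed

lemma sqrt_iter_dominated:
  assumes "norm x \<le> 1"
  shows "norm (sqrt_iter x n) \<le> sqrt_iter 1 n"
    and "norm (sqrt_iter x (Suc n) - sqrt_iter x n) \<le> sqrt_iter 1 (Suc n) - sqrt_iter 1 n"
proof -
  show 1: "norm (sqrt_iter x n) \<le> sqrt_iter 1 n" for n
  proof (induction n)
    case (Suc n)
    have "norm (sqrt_iter x n * sqrt_iter x n) \<le> sqrt_iter 1 n * sqrt_iter 1 n"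
      by (rule order_trans[OF norm_mult_ineq]) (intro mult_mono Suc; simp add: sqrt_iter_real_bounds)
    thus ?case using assms norm_triangle_ineq[of x "sqrt_iter x n * sqrt_iter x n"] by simp
  qed simp
  show "norm (sqrt_iter x (Suc n) - sqrt_iter x n) \<le> sqrt_iter 1 (Suc n) - sqrt_iter 1 n"
  proof (induction n)
    case 0 show ?case using assms by simp
  next
    case (Suc n)
    let ?a = "sqrt_iter x n" and ?b = "sqrt_iter x (Suc n)"
    let ?s = "sqrt_iter (1::real) n" and ?t = "sqrt_iter (1::real) (Suc n)"
    have "sqrt_iter x (Suc (Suc n)) - ?b = (1/2) *\<^sub>R (?b * ?b - ?a * ?a)"
      by (subst (1 2) sqrt_iter.simps(2)) (simp only: scaleR_diff_right[symmetric] add_diff_cancel_left)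
    also have "?b * ?b - ?a * ?a = ?b * (?b - ?a) + (?b - ?a) * ?a" by (simp add: algebra_simps del: sqrt_iter.simps)
    finally have e: "sqrt_iter x (Suc (Suc n)) - ?b = (1/2) *\<^sub>R (?b * (?b - ?a) + (?b - ?a) * ?a)" .
    have "norm (?b * (?b - ?a) + (?b - ?a) * ?a) \<le> norm (?b * (?b - ?a)) + norm ((?b - ?a) * ?a)"
      by (rule norm_triangle_ineq)
    also have "\<dots> \<le> norm ?b * norm (?b - ?a) + norm (?b - ?a) * norm ?a"
      by (intro add_mono norm_mult_ineq)
    also have "\<dots> \<le> ?t * (?t - ?s) + (?t - ?s) * ?s"
      using sqrt_iter_real_bounds[of n] sqrt_iter_real_bounds[of "Suc n"]
      by (intro add_mono mult_mono Suc 1) (simp_all del: sqrt_iter.simps)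
    also have "\<dots> = ?t * ?t - ?s * ?s" by (simp add: algebra_simps del: sqrt_iter.simps)
    finally have "norm (?b * (?b - ?a) + (?b - ?a) * ?a) \<le> ?t * ?t - ?s * ?s" .
    moreover have "sqrt_iter (1::real) (Suc (Suc n)) - ?t = (?t * ?t - ?s * ?s) / 2"
      by (subst (1 2) sqrt_iter.simps(2)) (simp add: field_simps del: sqrt_iter.simps)
    ultimately show ?case unfolding e by (simp del: sqrt_iter.simps)
  qed
qed

lemma sqrt_iter_mem:
  "closed_unital_subalgebra B \<Longrightarrow> x \<in> B \<Longrightarrow> sqrt_iter x n \<in> B"
  by (induction n)
    (auto simp: closed_unital_subalgebra_def intro!: subspace_0 subspace_add subspace_mul)

lemma sqrt_iter_star:
  "star x = (x::'a::cstar_algebra) \<Longrightarrow> star (sqrt_iter x n) = sqrt_iter x n"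
  by (induction n) (auto simp: star_scaleR star_add star_mult)

text \<open>The case \<open>norm x = 1\<close> is included, where a contraction argument would fail: the increments are
dominated by those of the bounded increasing scalar sequence, which makes the iterates Cauchy.\<close>

lemma norm_le_1_square_root:
  fixes x :: "'a::cstar_algebra"
  assumes "norm x \<le> 1" "star x = x"
  obtains s where "norm s \<le> 1" "star s = s" "(1 - s) * (1 - s) = 1 - x"
    "\<And>B. closed_unital_subalgebra B \<Longrightarrow> x \<in> B \<Longrightarrow> s \<in> B"
proof -
  let ?r = "sqrt_iter (1::real)" and ?S = "sqrt_iter x"
  have inc: "incseq ?r" by (rule incseq_SucI) (rule sqrt_iter_real_bounds)
  hence "convergent ?r"
    by (intro Bseq_mono_convergent BseqI'[where K = 1])
      (use sqrt_iter_real_bounds in \<open>auto simp: incseq_def\<close>)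
  hence C: "Cauchy ?r" by (simp add: Cauchy_convergent_iff)
  have diff: "norm (?S (m + k) - ?S m) \<le> ?r (m + k) - ?r m" for m k
  proof (induction k)
    case (Suc k)
    have "norm (?S (m + Suc k) - ?S m) \<le> norm (?S (Suc (m + k)) - ?S (m + k)) + norm (?S (m + k) - ?S m)"
      using norm_triangle_ineq[of "?S (Suc (m + k)) - ?S (m + k)" "?S (m + k) - ?S m"]
      by (simp del: sqrt_iter.simps)
    with Suc sqrt_iter_dominated(2)[OF assms(1), of "m + k"] show ?case by (simp del: sqrt_iter.simps)
  qed simp
  have "Cauchy ?S"
  proof (rule CauchyI)
    fix e :: real assume "e > 0"
    from CauchyD[OF C this] obtain M where M: "\<And>m n. m \<ge> M \<Longrightarrow> n \<ge> M \<Longrightarrow> norm (?r m - ?r n) < e" by blast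
    have "norm (?S n - ?S m) < e" if "m \<ge> M" "m \<le> n" for m n
      using diff[of m "n - m"] M[of n m] that by auto
    thus "\<exists>M. \<forall>m\<ge>M. \<forall>n\<ge>M. norm (?S m - ?S n) < e"
      by (metis nle_le norm_minus_commute)
  qed
  then obtain s where s: "?S \<longlonglongrightarrow> s" by (auto simp: Cauchy_convergent_iff convergent_def)
  have "(\<lambda>n. ?S (Suc n)) \<longlonglongrightarrow> (1/2) *\<^sub>R (x + s * s)"
    unfolding sqrt_iter.simps by (intro tendsto_intros s)
  hence "s = (1/2) *\<^sub>R (x + s * s)" using LIMSEQ_unique[OF LIMSEQ_Suc[OF s]] by blast
  hence "2 *\<^sub>R s = x + s * s" by (metis scaleR_half_double scaleR_2 scaleR_add_right)
  hence "(1 - s) * (1 - s) = 1 - x" by (simp add: algebra_simps scaleR_2)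
  moreover have "norm s \<le> 1"
  proof (rule LIMSEQ_le_const2[OF tendsto_norm[OF s]])
    show "\<exists>N. \<forall>n\<ge>N. norm (?S n) \<le> 1"
      using order_trans[OF sqrt_iter_dominated(1)[OF assms(1)] sqrt_iter_real_bounds(2)] by blast
  qed
  moreover have "star s = s"
    using LIMSEQ_unique[OF tendsto_star[OF s]] s by (simp add: sqrt_iter_star[OF assms(2)])
  moreover have "s \<in> B" if "closed_unital_subalgebra B" "x \<in> B" for B
    using that closed_sequentially[of B ?S s] s sqrt_iter_mem[OF that]
    by (simp add: closed_unital_subalgebra_def)
  ultimately show thesis using that by blast
qed

section \<open>Positive elements\<close>

text \<open>For self-adjoint \<open>x\<close> this says that the spectrum is nonnegative, expressed by the norm (Kelley and
Vaught). The condition forces \<open>0 \<le> t\<close>. With this definition sums of positive elements are visibly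
positive.\<close>

definition is_positive :: "'a::cstar_algebra \<Rightarrow> bool" where
  "is_positive x \<longleftrightarrow> star x = x \<and> (\<exists>t. norm (of_real t - x) \<le> t)"

lemma positive_star: "is_positive x \<Longrightarrow> star x = x"
  by (simp add: is_positive_def)

lemma positiveI: "star x = x \<Longrightarrow> norm (of_real t - x) \<le> t \<Longrightarrow> is_positive x"
  by (auto simp: is_positive_def)

lemma positive_add:
  assumes "is_positive x" "is_positive y"
  shows "is_positive (x + y)"
proof -
  from assms obtain s t where st: "norm (of_real s - x) \<le> s" "norm (of_real t - y) \<le> t"
    by (auto simp: is_positive_def)
  have "norm (of_real (s + t) - (x + y)) \<le> norm (of_real s - x) + norm (of_real t - y)"
    using norm_triangle_ineq[of "of_real s - x" "of_real t - y"] by (simp add: algebra_simps)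
  with st assms show ?thesis by (intro positiveI[of _ "s + t"]) (auto simp: star_add positive_star)
qed

lemma positive_scaleR:
  assumes "is_positive x" "0 \<le> r"
  shows "is_positive (r *\<^sub>R x)"
proof -
  from assms obtain s where s: "norm (of_real s - x) \<le> s" by (auto simp: is_positive_def)
  have "of_real (r * s) - r *\<^sub>R x = r *\<^sub>R (of_real s - x)" by (simp add: scaleR_conv_of_real algebra_simps)
  hence "norm (of_real (r * s) - r *\<^sub>R x) = r * norm (of_real s - x)" using assms by simp
  with s assms show ?thesis
    by (intro positiveI[of _ "r * s"]) (auto simp: star_scaleR positive_star mult_left_mono)
qed

lemma positive_of_real_iff: "is_positive (of_real r :: 'a::cstar_algebra) \<longleftrightarrow> 0 \<le> r"
proof
  assume "is_positive (of_real r :: 'a)"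
  then obtain t where "norm (of_real t - of_real r :: 'a) \<le> t" by (auto simp: is_positive_def)
  hence "\<bar>t - r\<bar> \<le> t" by (metis norm_of_real of_real_diff)
  thus "0 \<le> r" by linarith
qed (auto intro: positiveI[of _ r])

lemma positive_0 [simp]: "is_positive (0::'a::cstar_algebra)"
  using positive_of_real_iff[of 0] by simp

lemma positive_1 [simp]: "is_positive (1::'a::cstar_algebra)"
  using positive_of_real_iff[of 1] by simp

lemma positive_sum: "(\<And>i. i \<in> S \<Longrightarrow> is_positive (f i)) \<Longrightarrow> is_positive (sum f S)"
  by (induction S rule: infinite_finite_induct) (auto intro: positive_add)

lemma positive_norm_minus: "star x = x \<Longrightarrow> is_positive (of_real (norm x) - x)"
  by (rule positiveI[of _ "norm x"]) (auto simp: star_diff)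

lemma positive_norm_plus: "star x = x \<Longrightarrow> is_positive (of_real (norm x) + x)"
  using positive_norm_minus[of "-x"] by simp

lemma positive_square_root:
  assumes "is_positive a"
  obtains r where "is_positive r" "r * r = a" "\<And>B. closed_unital_subalgebra B \<Longrightarrow> a \<in> B \<Longrightarrow> r \<in> B"
proof -
  from assms obtain t where t: "norm (of_real t - a) \<le> t" by (auto simp: is_positive_def)
  have sa: "star a = a" using assms by (rule positive_star)
  have "t \<ge> 0" using t norm_ge_zero order_trans by blast
  show thesis
  proof (cases "t = 0")
    case True
    hence "a = 0" using t by simp
    thus thesis using that[of 0] by simp
  next
    case False
    with \<open>t \<ge> 0\<close> have t0: "t > 0" by simp
    define x where "x = 1 - (1/t) *\<^sub>R a"
    have "x = (1/t) *\<^sub>R (of_real t - a)" using t0 by (simp add: x_def of_real_def algebra_simps)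
    hence "norm x = norm (of_real t - a) / t" using t0 by (simp only: norm_scaleR) simp
    hence "norm x \<le> 1" using t t0 by simp
    moreover have "star x = x" by (simp add: x_def star_diff star_scaleR sa)
    ultimately obtain s where s: "norm s \<le> 1" "star s = s" "(1 - s) * (1 - s) = 1 - x"
      "\<And>B. closed_unital_subalgebra B \<Longrightarrow> x \<in> B \<Longrightarrow> s \<in> B" by (rule norm_le_1_square_root) metis
    define r where "r = sqrt t *\<^sub>R (1 - s)"
    have "r * r = t *\<^sub>R ((1 - s) * (1 - s))" using t0 by (simp add: r_def)
    also have "\<dots> = a" using t0 by (simp add: s(3) x_def)
    finally have rr: "r * r = a" .
    have "norm (of_real (sqrt t) - r) = sqrt t * norm s" using t0 by (simp add: r_def of_real_def algebra_simps)
    also have "\<dots> \<le> sqrt t" using s(1) t0 by (simp add: mult_left_le)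
    finally have "is_positive r" by (intro positiveI) (auto simp: r_def star_scaleR star_diff s(2))
    moreover have "r \<in> B" if B: "closed_unital_subalgebra B" "a \<in> B" for B
    proof -
      have "x \<in> B" using B unfolding x_def closed_unital_subalgebra_def
        by (auto intro!: subspace_diff subspace_mul)
      hence "s \<in> B" using s(4) B by blast
      thus ?thesis using B unfolding r_def closed_unital_subalgebra_def
        by (auto intro!: subspace_diff subspace_mul)
    qed
    ultimately show thesis using that rr by blast
  qed
qed

lemma closed_unital_subalgebra_commuteD:
  assumes "\<And>B. closed_unital_subalgebra B \<Longrightarrow> a \<in> B \<Longrightarrow> r \<in> B" "a * c = c * a"
  shows "r * c = c * (r::'a::real_normed_algebra_1)"
  using assms(1)[OF closed_unital_subalgebra_commutant[of c]] assms(2) by simp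

lemma ii_scaleC_ii: "\<i> *\<^sub>C \<i> *\<^sub>C x = - (x::'a::cstar_algebra)"
  using scaleR_scaleC[of "-1" x] by (simp add: scaleC_scaleC)

lemma scaleC_minus_left: "(- c) *\<^sub>C x = - (c *\<^sub>C (x::'a::cstar_algebra))"
  by (rule complex_vector.scale_minus_left)

text \<open>Commuting self-adjoint \<open>y\<close> and \<open>r\<close> with \<open>y\<^sup>2 + r\<^sup>2 = t\<close> form a
multiple of a unitary, whose norm the C*-identity computes. This is the substitute for functional calculus in norm
estimates.\<close>

lemma commuting_squares:
  fixes y r :: "'a::cstar_algebra"
  assumes "star y = y" "star r = r" "y * r = r * y" "y * y + r * r = of_real t"
  defines "u \<equiv> y + \<i> *\<^sub>C r"
  shows "(norm u)\<^sup>2 = \<bar>t\<bar>" "star u = y - \<i> *\<^sub>C r"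
proof -
  show su: "star u = y - \<i> *\<^sub>C r"
    using assms by (simp add: u_def star_add star_scaleC scaleC_minus_left)
  have "star u * u = of_real t"
    unfolding su unfolding u_def using assms(3,4)
    by (simp add: algebra_simps mult_scaleC_left mult_scaleC_right ii_scaleC_ii)
  thus "(norm u)\<^sup>2 = \<bar>t\<bar>" using norm_star_mult_self[of u] by simp
qed

text \<open>With \<open>t = (norm y)\<^sup>2\<close> the element \<open>t - y\<^sup>2\<close> has a square root
\<open>r\<close>, and \<open>y + \<i> r\<close>, a multiple of a unitary, has norm \<open>norm y\<close> and imaginary part
\<open>r\<close>; hence \<open>norm r \<le> norm y\<close>, which bounds \<open>t - y\<^sup>2 = r\<^sup>2\<close> in
norm.\<close>

lemma positive_self_adjoint_square:
  fixes y :: "'a::cstar_algebra"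
  assumes y: "star y = y"
  shows "is_positive (y * y)"
proof -
  let ?t = "(norm y)\<^sup>2"
  define a where "a = of_real ?t - y * y"
  have ta: "of_real ?t - a = y * y" by (simp add: a_def)
  have "norm (of_real ?t - a) \<le> ?t" unfolding ta using norm_square_self_adjoint[OF y] by simp
  hence "is_positive a" by (intro positiveI[of a ?t]) (simp_all add: a_def star_diff star_mult y del: of_real_power)
  then obtain r where r: "is_positive r" "r * r = a"
    "\<And>B. closed_unital_subalgebra B \<Longrightarrow> a \<in> B \<Longrightarrow> r \<in> B" by (rule positive_square_root) metis
  have "r * y = y * r" by (rule closed_unital_subalgebra_commuteD[of a r y, OF r(3)]) (simp_all add: a_def algebra_simps of_real_commute del: of_real_power)
  hence c: "y * r = r * y" by simp
  have e: "y * y + r * r = of_real ?t" by (simp add: r(2) a_def)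
  define u where "u = y + \<i> *\<^sub>C r"
  note cs = commuting_squares[OF y positive_star[OF r(1)] c e, folded u_def]
  have nu: "norm u = norm y" using cs(1) by (simp add: power2_eq_iff_nonneg)
  \<comment> \<open>\<open>r\<close> is the imaginary part of \<open>u\<close>\<close>
  have "2 *\<^sub>R (\<i> *\<^sub>C r) = u - star u" unfolding cs(2) by (simp add: u_def scaleR_2)
  hence "2 * norm r \<le> norm u + norm (star u)"
    using norm_triangle_ineq4[of u "star u"] by (metis norm_scaleC norm_scaleR norm_ii mult_1 abs_numeral)
  hence "norm r \<le> norm y" using nu by simp
  hence "norm a \<le> ?t"
    using norm_square_self_adjoint[OF positive_star[OF r(1)]] r(2) by (simp add: power_mono)
  hence "norm (of_real ?t - y * y) \<le> ?t" by (simp only: a_def)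
  thus ?thesis by (rule positiveI[rotated]) (simp add: star_mult y)
qed

text \<open>For the roots \<open>p\<close> and \<open>q\<close> of \<open>t - s\<close> and \<open>t + s\<close>, the element
\<open>u = p + \<i> q\<close> satisfies \<open>(norm u)\<^sup>2 = 2 t\<close>, and \<open>-2 s\<close> is the real part of
\<open>u\<^sup>2\<close>.\<close>

lemma norm_le_of_positive:
  fixes s :: "'a::cstar_algebra"
  assumes "is_positive (of_real t - s)" "is_positive (of_real t + s)"
  shows "norm s \<le> t"
proof -
  have sum: "(of_real t - s) + (of_real u + s) = of_real (t + u)" for u by simp
  have "is_positive (of_real (t + t) :: 'a)" using positive_add[OF assms] by (simp only: sum)
  hence t: "t \<ge> 0" unfolding positive_of_real_iff by simp
  from assms(1) obtain p where p: "is_positive p" "p * p = of_real t - s"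
    "\<And>B. closed_unital_subalgebra B \<Longrightarrow> of_real t - s \<in> B \<Longrightarrow> p \<in> B" by (rule positive_square_root) metis
  from assms(2) obtain q where q: "is_positive q" "q * q = of_real t + s"
    "\<And>B. closed_unital_subalgebra B \<Longrightarrow> of_real t + s \<in> B \<Longrightarrow> q \<in> B" by (rule positive_square_root) metis
  have "p * s = s * p" by (rule closed_unital_subalgebra_commuteD[of "of_real t - s" p s, OF p(3)]) (simp_all add: algebra_simps of_real_commute)
  hence "(of_real t + s) * p = p * (of_real t + s)" by (simp add: algebra_simps of_real_commute)
  with q(3) have "q * p = p * q" by (rule closed_unital_subalgebra_commuteD)
  hence c: "p * q = q * p" by simp
  have e: "p * p + q * q = of_real (t + t)" by (simp only: p q sum)
  define u where "u = p + \<i> *\<^sub>C q"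
  note cs = commuting_squares[OF positive_star[OF p(1)] positive_star[OF q(1)] c e, folded u_def]
  have "u * u + star u * star u
      = (p + \<i> *\<^sub>C q) * (p + \<i> *\<^sub>C q) + (p - \<i> *\<^sub>C q) * (p - \<i> *\<^sub>C q)"
    unfolding cs(2) unfolding u_def ..
  also have "\<dots> = 2 *\<^sub>R (p * p) - 2 *\<^sub>R (q * q)"
    using c by (simp add: algebra_simps mult_scaleC_left mult_scaleC_right ii_scaleC_ii scaleR_2)
  also have "\<dots> = - (2 *\<^sub>R (2 *\<^sub>R s))"
    unfolding p(2) q(2) by (simp only: scaleR_2) simp
  finally have "4 * norm s = norm (u * u + star u * star u)" by simp
  also have "\<dots> \<le> norm (u * u) + norm (star u * star u)" by (rule norm_triangle_ineq)
  also have "\<dots> \<le> norm u * norm u + norm u * norm u"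
    using norm_mult_ineq[of u u] norm_mult_ineq[of "star u" "star u"] by simp
  also have "\<dots> = 4 * t" using cs(1) t by (simp add: power2_eq_square)
  finally show ?thesis by simp
qed

lemma positive_mult_commuting:
  assumes "is_positive a" "is_positive b" "a * b = b * a"
  shows "is_positive (a * b)"
proof -
  from assms(1) obtain p where p: "is_positive p" "p * p = a"
    "\<And>B. closed_unital_subalgebra B \<Longrightarrow> a \<in> B \<Longrightarrow> p \<in> B" by (rule positive_square_root) metis
  from assms(2) obtain q where q: "is_positive q" "q * q = b"
    "\<And>B. closed_unital_subalgebra B \<Longrightarrow> b \<in> B \<Longrightarrow> q \<in> B" by (rule positive_square_root) metis
  have "p * b = b * p" using p(3) assms(3) by (rule closed_unital_subalgebra_commuteD)
  hence "b * p = p * b" by simp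
  with q(3) have c: "q * p = p * q" by (rule closed_unital_subalgebra_commuteD)
  have "is_positive ((p * q) * (p * q))"
    by (rule positive_self_adjoint_square) (simp add: star_mult positive_star[OF p(1)] positive_star[OF q(1)] c)
  also have "(p * q) * (p * q) = (p * p) * (q * q)" using c by (metis mult.assoc)
  finally show ?thesis by (simp add: p q)
qed

text \<open>The inverse is the fixed point of the contraction \<open>w \<mapsto> 1 + x w\<close>; running the fixed point
theorem inside a closed subalgebra shows that the inverse belongs to it.\<close>

lemma one_minus_inverse:
  fixes x :: "'a::{real_normed_algebra_1,banach}"
  assumes "norm x < 1"
  obtains w where "(1 - x) * w = 1" "w * (1 - x) = 1"
    "\<And>B. closed_unital_subalgebra B \<Longrightarrow> x \<in> B \<Longrightarrow> w \<in> B"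
proof -
  have fixp: "\<exists>!w. w \<in> B \<and> 1 + x * w = w"
    if B: "closed B" "B \<noteq> {}" "\<And>w. w \<in> B \<Longrightarrow> 1 + x * w \<in> B" for B
  proof (rule Banach_fix[where c = "norm x" and f = "\<lambda>w. 1 + x * w"])
    show "complete B" using B(1) by (simp add: complete_eq_closed)
    show "(\<lambda>w. 1 + x * w) ` B \<subseteq> B" using B(3) by blast
    fix v w
    have "dist (1 + x * v) (1 + x * w) = norm (x * (v - w))"
      by (simp add: dist_norm right_diff_distrib)
    also have "\<dots> \<le> norm x * dist v w" unfolding dist_norm by (rule norm_mult_ineq)
    finally show "dist (1 + x * v) (1 + x * w) \<le> norm x * dist v w" .
  qed (use B(2) assms in simp_all)
  from fixp[of UNIV] obtain w where w: "1 + x * w = w" and u: "\<And>v. 1 + x * v = v \<Longrightarrow> v = w" by auto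
  have mem: "w \<in> B" if "closed_unital_subalgebra B" "x \<in> B" for B
  proof -
    have "\<exists>!w. w \<in> B \<and> 1 + x * w = w"
      using that by (intro fixp) (auto simp: closed_unital_subalgebra_def intro!: subspace_add)
    thus ?thesis using u by auto
  qed
  have "w * x = x * w" using mem[OF closed_unital_subalgebra_commutant[of x]] by simp
  with w have "(1 - x) * w = 1" "w * (1 - x) = 1" by (simp_all add: algebra_simps)
  thus thesis using that mem by blast
qed

text \<open>Strict positivity \<open>a \<ge> \<delta>\<close> means that \<open>a\<close>, after scaling, has distance less
than one from the unit.\<close>

lemma positive_inverse:
  fixes a :: "'a::cstar_algebra"
  assumes "is_positive (a - of_real \<delta>)" "\<delta> > 0"
  obtains w where "a * w = 1" "w * a = 1" "is_positive w"
    "\<And>B. closed_unital_subalgebra B \<Longrightarrow> a \<in> B \<Longrightarrow> w \<in> B"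
proof -
  from assms obtain t where t: "norm (of_real t - (a - of_real \<delta>)) \<le> t" by (auto simp: is_positive_def)
  have sa: "star a = a" using positive_star[OF assms(1)] by (simp add: star_diff)
  have pa: "is_positive a" using positive_add[OF assms(1), of "of_real \<delta>"] assms(2) by (simp add: positive_of_real_iff)
  define T where "T = t + \<delta>"
  have "t \<ge> 0" using t norm_ge_zero order_trans by blast
  hence T: "T > 0" "t < T" using assms(2) by (auto simp: T_def)
  define x where "x = 1 - (1/T) *\<^sub>R a"
  have "x = (1/T) *\<^sub>R (of_real t - (a - of_real \<delta>))" using T by (simp add: x_def T_def of_real_def algebra_simps flip: scaleR_add_left)
  hence "norm x = norm (of_real t - (a - of_real \<delta>)) / T" using T by (simp only: norm_scaleR) simp
  hence "norm x \<le> t / T" using t T by (simp add: divide_right_mono)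
  also have "\<dots> < 1" using T by simp
  finally obtain v where v: "(1 - x) * v = 1" "v * (1 - x) = 1"
    "\<And>B. closed_unital_subalgebra B \<Longrightarrow> x \<in> B \<Longrightarrow> v \<in> B" by (rule one_minus_inverse) metis
  define w where "w = (1/T) *\<^sub>R v"
  have w: "a * w = 1" "w * a = 1" using v(1,2) by (simp_all add: x_def w_def)
  have mem: "w \<in> B" if B: "closed_unital_subalgebra B" "a \<in> B" for B
  proof -
    have "x \<in> B" using B unfolding x_def closed_unital_subalgebra_def
      by (auto intro!: subspace_diff subspace_mul)
    hence "v \<in> B" using v(3) B by blast
    thus ?thesis using B unfolding w_def closed_unital_subalgebra_def by (auto intro!: subspace_mul)
  qed
  have "star w * a = 1" using arg_cong[OF w(1), of star] by (simp add: star_mult sa)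
  hence sw: "star w = w" by (metis mult.assoc mult_1 mult_1_right w(1))
  have e: "a * (w * w) = w" "w * w * a = w" using w by (simp_all add: mult.assoc) (simp flip: mult.assoc)
  have "is_positive (a * (w * w))"
    by (intro positive_mult_commuting pa positive_self_adjoint_square sw) (simp only: e)
  hence "is_positive w" by (simp only: e)
  thus thesis using that w mem by blast
qed

definition re_part :: "'a::cstar_algebra \<Rightarrow> 'a" where "re_part x = (1/2) *\<^sub>R (x + star x)"
definition im_part :: "'a::cstar_algebra \<Rightarrow> 'a" where "im_part x = (1/2) *\<^sub>R (\<i> *\<^sub>C (star x - x))"

lemma scaleR_scaleC_commute: "r *\<^sub>R (c *\<^sub>C x) = c *\<^sub>C (r *\<^sub>R (x::'a::cstar_algebra))"
  by (simp add: scaleR_scaleC scaleC_scaleC mult.commute)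

lemma scaleC_diff_right: "c *\<^sub>C (x - y) = c *\<^sub>C x - c *\<^sub>C (y::'a::cstar_algebra)"
  by (rule complex_vector.scale_right_diff_distrib)

lemma star_re_part [simp]: "star (re_part x) = re_part x" and star_im_part [simp]: "star (im_part x) = im_part x"
  by (simp_all add: re_part_def im_part_def star_scaleR star_add star_star star_scaleC star_diff add.commute
      scaleC_minus_left scaleC_diff_right)

lemma re_im_part: "x = re_part x + \<i> *\<^sub>C im_part x"
proof -
  have "\<i> *\<^sub>C im_part x = (1/2) *\<^sub>R (x - star x)"
    by (simp add: im_part_def scaleR_scaleC_commute[symmetric] ii_scaleC_ii)
  hence "re_part x + \<i> *\<^sub>C im_part x = (1/2) *\<^sub>R (x + x)" by (simp add: re_part_def flip: scaleR_add_right)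
  thus ?thesis by (simp flip: scaleR_2)
qed

text \<open>The positivity of \<open>star x * x + x * star x\<close> is elementary, which is what allows the sign of
\<open>star x * x\<close> to be compared with that of \<open>x * star x\<close>.\<close>

lemma star_mult_sum_self:
  "star x * x + x * star x = 2 *\<^sub>R (re_part x * re_part x + im_part x * im_part (x::'a::cstar_algebra))"
proof -
  have 1: "star x = re_part x - \<i> *\<^sub>C im_part x"
    by (subst re_im_part[of x]) (simp add: star_add star_scaleC scaleC_minus_left)
  have "(u - \<i> *\<^sub>C v) * (u + \<i> *\<^sub>C v) + (u + \<i> *\<^sub>C v) * (u - \<i> *\<^sub>C v) = 2 *\<^sub>R (u * u + v * v)"
    for u v :: 'a
    by (simp add: algebra_simps mult_scaleC_left mult_scaleC_right ii_scaleC_ii scaleR_2)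
  from this[of "re_part x" "im_part x"] show ?thesis by (simp flip: 1 re_im_part)
qed

text \<open>Let \<open>c = - star y * y\<close> be positive and nonzero. Then \<open>y * star y\<close> is positive as well,
so \<open>l + y * star y\<close> is invertible for every \<open>l > 0\<close>. Invertibility passes from \<open>l + y * star
y\<close> to \<open>l + star y * y = l - c\<close>. But at \<open>l = norm c\<close> this is impossible: a positive
invertible \<open>norm c - c\<close> would be bounded below by a positive number, and \<open>norm c\<close> could be
lowered.\<close>

lemma negative_star_mult_self:
  fixes y :: "'a::cstar_algebra"
  assumes "is_positive (- (star y * y))"
  shows "y = 0"
proof (rule ccontr)
  assume "y \<noteq> 0"
  define c where "c = - (star y * y)"
  define q where "q = y * star y"
  have c: "is_positive c" using assms by (simp add: c_def)
  have c0: "c \<noteq> 0" using \<open>y \<noteq> 0\<close> norm_star_mult_self[of y] by (auto simp: c_def)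
  define l where "l = norm c"
  have l: "l > 0" using c0 by (simp add: l_def)
  have "q = 2 *\<^sub>R (re_part y * re_part y + im_part y * im_part y) + c"
    using star_mult_sum_self[of y] unfolding q_def c_def by (metis add.commute add_diff_cancel_left' diff_conv_add_uminus)
  hence "is_positive q" using c by (auto intro!: positive_add positive_scaleR positive_self_adjoint_square)
  hence "is_positive ((of_real l + q) - of_real l)" by simp
  then obtain w where w: "(of_real l + q) * w = 1" "w * (of_real l + q) = 1" using l by (rule positive_inverse) metis
  define r where "r = of_real l - c"
  \<comment> \<open>the explicit inverse of \<open>l + star y * y\<close>, given the inverse \<open>w\<close> of \<open>l + y * star y\<close>\<close>
  define z where "z = (1/l) *\<^sub>R (1 - star y * w * y)"
  have "(of_real l + star y * y) * (star y * w * y) = star y * ((of_real l + q) * w) * y"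
    by (simp add: q_def distrib_left distrib_right mult.assoc) (simp add: of_real_def)
  hence "(of_real l + star y * y) * (1 - star y * w * y) = of_real l"
    by (simp add: w right_diff_distrib)
  hence rz: "r * z = 1" using l by (simp add: r_def z_def c_def of_real_def)
  have "(star y * w * y) * (of_real l + star y * y) = star y * (w * (of_real l + q)) * y"
    by (simp add: q_def distrib_left distrib_right mult.assoc) (simp add: of_real_def)
  hence "(1 - star y * w * y) * (of_real l + star y * y) = of_real l"
    by (simp add: w left_diff_distrib)
  hence zr: "z * r = 1" using l by (simp add: r_def z_def c_def of_real_def)
  have r: "is_positive r" using positive_norm_minus[OF positive_star[OF c]] by (simp add: r_def l_def)
  have "star z * r = 1" using arg_cong[OF rz, of star] by (simp add: star_mult positive_star[OF r])
  hence sz: "star z = z" by (metis mult.assoc mult_1 mult_1_right rz)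
  have z0: "z \<noteq> 0" using rz by auto
  \<comment> \<open>\<open>z \<le> norm z\<close>, multiplied by \<open>r = 1 / z\<close>, becomes the lower bound \<open>r \<ge> 1 / norm z\<close>\<close>
  have "is_positive (r * (of_real (norm z) - z))"
    by (intro positive_mult_commuting r positive_norm_minus sz) (simp add: algebra_simps rz zr of_real_commute)
  hence "is_positive (norm z *\<^sub>R r - 1)" by (simp add: algebra_simps rz scaleR_conv_of_real of_real_commute)
  from positive_scaleR[OF this, of "1 / norm z"]
  have "is_positive (r - of_real (1 / norm z))" using z0 by (simp add: algebra_simps of_real_def)
  hence p: "is_positive (of_real (l - 1 / norm z) - c)" by (simp add: r_def algebra_simps)
  hence "is_positive (of_real (l - 1 / norm z) :: 'a)" using positive_add[OF p c] by simp
  moreover from this have "is_positive (of_real (l - 1 / norm z) + c)" using c positive_add by blast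
  ultimately have "norm c \<le> l - 1 / norm z" using p norm_le_of_positive by blast
  thus False using z0 by (simp add: l_def)
qed

text \<open>Let \<open>a\<close> be the absolute value of \<open>s = star x * x\<close>. Then \<open>m = a - s\<close> is
twice the negative part of \<open>s\<close>, and \<open>s m = - a m\<close>. So \<open>x m\<close> has the negative square
\<open>star (x m) (x m) = - a m\<^sup>2\<close> and must vanish. This gives \<open>m\<^sup>4 = 0\<close> and therefore
\<open>s = a\<close>.\<close>

lemma positive_star_mult_self:
  fixes x :: "'a::cstar_algebra"
  shows "is_positive (star x * x)"
proof -
  define s where "s = star x * x"
  have s: "star s = s" by (simp add: s_def star_mult star_star)
  obtain a where a: "is_positive a" "a * a = s * s"
    "\<And>B. closed_unital_subalgebra B \<Longrightarrow> s * s \<in> B \<Longrightarrow> a \<in> B"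
    using positive_square_root[OF positive_self_adjoint_square[OF s]] by metis
  have as: "a * s = s * a" by (rule closed_unital_subalgebra_commuteD[of "s * s" a s, OF a(3)]) (auto simp: mult.assoc)
  define m where "m = a - s"
  have sm: "star m = m" by (simp add: m_def star_diff s positive_star[OF a(1)])
  have sm_am: "s * m = - (a * m)" by (simp add: m_def algebra_simps as a(2))
  have mm: "m * s = - (m * a)" by (simp add: m_def algebra_simps as a(2))
  have am: "a * m = m * a" by (simp add: m_def algebra_simps as)
  have amm: "star (x * m) * (x * m) = - (a * (m * m))"
  proof -
    have "star (x * m) * (x * m) = (m * s) * m" by (simp add: star_mult sm s_def mult.assoc)
    also have "\<dots> = - (a * (m * m))" by (simp add: mm am[symmetric] mult.assoc)
    finally show ?thesis .
  qed
  have "a * (m * m) = (m * a) * m" by (simp add: am flip: mult.assoc)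
  also have "\<dots> = (m * m) * a" by (simp add: am mult.assoc)
  finally have "is_positive (a * (m * m))"
    by (intro positive_mult_commuting a(1) positive_self_adjoint_square sm)
  hence "x * m = 0" by (intro negative_star_mult_self) (simp add: amm)
  hence z: "a * (m * m) = 0" using amm by simp
  have "m * m = (a - s) * m" by (simp only: m_def)
  hence mm2: "m * m = 2 *\<^sub>R (a * m)" by (simp add: left_diff_distrib sm_am scaleR_2)
  have "(m * m) * (m * m) = (2 *\<^sub>R (a * m)) * (m * m)" using mm2 by simp
  also have "\<dots> = 2 *\<^sub>R (a * (m * m) * m)" by (simp add: mult.assoc)
  finally have "(m * m) * (m * m) = 2 *\<^sub>R (a * (m * m) * m)" .
  hence "(m * m) * (m * m) = 0" by (simp add: z)
  hence "norm (m * m) = 0" using norm_square_self_adjoint[of "m * m"] sm by (simp add: star_mult)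
  hence "m = 0" using norm_square_self_adjoint[of m] sm by simp
  thus ?thesis using a(1) by (simp add: m_def s_def)
qed

section \<open>Real functionals from total cones\<close>

text \<open>A convex cone \<open>Q\<close> that contains the positive elements and one of \<open>x\<close> and \<open>-
x\<close> for each \<open>x\<close>, but not \<open>-1\<close>, is a half-space up to its boundary; the functional that it
determines is \<open>functional\<close> below.\<close>

locale total_cone =
  fixes V Q :: "'a::cstar_algebra set"
  assumes V: "subspace V" "1 \<in> V" "\<And>x. x \<in> V \<Longrightarrow> star x = x"
    and Q_subset: "Q \<subseteq> V"
    and Q_add: "\<And>x y. x \<in> Q \<Longrightarrow> y \<in> Q \<Longrightarrow> x + y \<in> Q"
    and Q_scaleR: "\<And>r x. 0 \<le> r \<Longrightarrow> x \<in> Q \<Longrightarrow> r *\<^sub>R x \<in> Q"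
    and Q_positive: "\<And>x. x \<in> V \<Longrightarrow> is_positive x \<Longrightarrow> x \<in> Q"
    and Q_proper: "- 1 \<notin> Q"
    and Q_total: "\<And>x. x \<in> V \<Longrightarrow> x \<in> Q \<or> - x \<in> Q"
begin

lemma of_real_V: "of_real r \<in> V"
  using V(1,2) by (simp add: of_real_def subspace_mul)

lemma of_real_Q: "of_real r \<in> Q \<longleftrightarrow> 0 \<le> r"
proof
  assume *: "of_real r \<in> Q"
  show "0 \<le> r"
  proof (rule ccontr)
    assume "\<not> 0 \<le> r"
    hence "(1 / - r) *\<^sub>R of_real r = (-1::'a)" by (simp add: of_real_def)
    moreover have "(1 / - r) *\<^sub>R of_real r \<in> Q" using * \<open>\<not> 0 \<le> r\<close> by (intro Q_scaleR) (auto simp: field_simps)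
    ultimately show False using Q_proper by simp
  qed
qed (auto intro: Q_positive of_real_V simp: positive_of_real_iff)

text \<open>The number \<open>x\<close> is the cut that \<open>Q\<close>, as an order, makes at \<open>a\<close> in the line
of scalars. The margin \<open>e\<close> is there because \<open>Q\<close> may fail to be closed.\<close>

definition cut :: "'a \<Rightarrow> real \<Rightarrow> bool" where
  "cut a x \<longleftrightarrow> (\<forall>e>0. a - of_real (x - e) \<in> Q \<and> of_real (x + e) - a \<in> Q)"

lemma cut_exists:
  assumes a: "a \<in> V"
  shows "\<exists>x. cut a x"
proof -
  define S where "S = {r. a - of_real r \<in> Q}"
  have "- norm a \<in> S"
    using positive_norm_plus[OF V(3)[OF a]] a V(1) of_real_V[of "norm a"]
    by (auto simp: S_def add.commute intro!: Q_positive subspace_add)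
  have le: "r \<le> norm a" if "r \<in> S" for r
  proof -
    have "of_real (norm a) - a \<in> Q"
      using positive_norm_minus[OF V(3)[OF a]] a V(1) of_real_V
      by (intro Q_positive subspace_diff)
    hence "of_real (norm a - r) \<in> Q" using Q_add[of "of_real (norm a) - a" "a - of_real r"] that by (simp add: S_def)
    thus ?thesis by (simp add: of_real_Q del: of_real_diff)
  qed
  hence bdd: "bdd_above S" by (auto simp: bdd_above_def)
  have "cut a (Sup S)"
    unfolding cut_def
  proof (intro allI impI conjI)
    fix e :: real assume e: "e > 0"
    then obtain r where r: "r \<in> S" "Sup S - e < r"
      using less_cSupD[of S "Sup S - e"] \<open>- norm a \<in> S\<close> by auto
    hence "of_real (r - (Sup S - e)) \<in> Q" by (subst of_real_Q) simp
    moreover have "a - of_real r \<in> Q" using r by (simp add: S_def)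
    ultimately have "(a - of_real r) + of_real (r - (Sup S - e)) \<in> Q" by (intro Q_add)
    thus "a - of_real (Sup S - e) \<in> Q" by (simp add: algebra_simps)
    have "Sup S + e \<notin> S" using cSup_upper[OF _ bdd, of "Sup S + e"] e by auto
    moreover have "a - of_real (Sup S + e) \<in> V" using a of_real_V V(1) by (intro subspace_diff)
    ultimately show "of_real (Sup S + e) - a \<in> Q" using Q_total by (fastforce simp: S_def)
  qed
  thus ?thesis ..
qed

lemma cut_le:
  assumes "cut a x" "cut a y" shows "x \<le> y"
proof (rule field_le_epsilon)
  fix e :: real assume "e > 0"
  hence "a - of_real (x - e/2) \<in> Q" "of_real (y + e/2) - a \<in> Q" using assms by (auto simp: cut_def)
  from Q_add[OF this] have "of_real (y + e - x) \<in> Q" by (simp add: algebra_simps of_real_def flip: scaleR_add_left)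
  thus "x \<le> y + e" by (simp add: of_real_Q del: of_real_diff of_real_add)
qed

lemma cut_unique: "cut a x \<Longrightarrow> cut a y \<Longrightarrow> x = y"
  by (intro antisym cut_le)

lemma cut_add:
  assumes "cut a x" "cut b y"
  shows "cut (a + b) (x + y)"
  unfolding cut_def
proof (intro allI impI)
  fix e :: real assume "e > 0"
  hence "a - of_real (x - e/2) \<in> Q \<and> of_real (x + e/2) - a \<in> Q" "b - of_real (y - e/2) \<in> Q \<and> of_real (y + e/2) - b \<in> Q"
    using assms by (auto simp: cut_def)
  hence "(a - of_real (x - e/2)) + (b - of_real (y - e/2)) \<in> Q" "(of_real (x + e/2) - a) + (of_real (y + e/2) - b) \<in> Q"
    using Q_add by blast+
  thus "a + b - of_real (x + y - e) \<in> Q \<and> of_real (x + y + e) - (a + b) \<in> Q"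
    by (simp add: algebra_simps of_real_def flip: scaleR_add_left)
qed

lemma cut_minus: "cut a x \<Longrightarrow> cut (- a) (- x)"
  unfolding cut_def by (auto simp: algebra_simps)

lemma cut_scaleR_pos:
  assumes "cut a x" "r > 0"
  shows "cut (r *\<^sub>R a) (r * x)"
  unfolding cut_def
proof (intro allI impI)
  fix e :: real assume "e > 0"
  hence "a - of_real (x - e/r) \<in> Q \<and> of_real (x + e/r) - a \<in> Q" using assms by (auto simp: cut_def)
  hence "r *\<^sub>R (a - of_real (x - e/r)) \<in> Q \<and> r *\<^sub>R (of_real (x + e/r) - a) \<in> Q"
    using Q_scaleR assms(2) by auto
  thus "r *\<^sub>R a - of_real (r * x - e) \<in> Q \<and> of_real (r * x + e) - r *\<^sub>R a \<in> Q"
    using assms(2) by (simp add: algebra_simps of_real_def)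
qed

lemma cut_of_real: "cut (of_real r) r"
  unfolding cut_def by (auto simp: of_real_Q simp flip: of_real_diff)

lemma cut_scaleR:
  assumes "cut a x"
  shows "cut (r *\<^sub>R a) (r * x)"
proof -
  consider "r > 0" | "r = 0" | "- r > 0" by linarith
  thus ?thesis
  proof cases
    case 3 thus ?thesis using cut_minus[OF cut_scaleR_pos[OF assms 3]] by simp
  qed (use assms cut_of_real[of 0] cut_scaleR_pos in auto)
qed

lemma cut_nonneg:
  assumes "a \<in> Q" "cut a x"
  shows "0 \<le> x"
proof (rule field_le_epsilon)
  fix e :: real assume "e > 0"
  hence "of_real (x + e) - a \<in> Q" using assms(2) by (auto simp: cut_def)
  from Q_add[OF assms(1) this] have "of_real (x + e) \<in> Q" by simp
  thus "0 \<le> x + e" by (simp add: of_real_Q del: of_real_add)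
qed

definition functional :: "'a \<Rightarrow> real" where "functional a = (THE x. cut a x)"

lemma functional_eqI: "cut a x \<Longrightarrow> functional a = x"
  unfolding functional_def using cut_unique by blast

lemma cut_functional: "a \<in> V \<Longrightarrow> cut a (functional a)"
  using cut_exists functional_eqI by blast

lemma functional_add: "a \<in> V \<Longrightarrow> b \<in> V \<Longrightarrow> functional (a + b) = functional a + functional b"
  by (intro functional_eqI cut_add cut_functional)

lemma functional_scaleR: "a \<in> V \<Longrightarrow> functional (r *\<^sub>R a) = r * functional a"
  by (intro functional_eqI cut_scaleR cut_functional)

lemma functional_of_real: "functional (of_real r) = r"
  by (intro functional_eqI cut_of_real)

lemma functional_nonneg: "a \<in> Q \<Longrightarrow> 0 \<le> functional a"
  using cut_nonneg cut_functional Q_subset by blast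

end

text \<open>Zorn's lemma yields a maximal cone that is stable under multiplication by the set \<open>S\<close> of positive
elements. Two instances matter: with \<open>S\<close> the nonnegative scalars this is the Hahn-Banach theorem for states, and
with \<open>S\<close> all positive elements of an abelian algebra it produces characters.

Maximality makes the cone total. If neither \<open>a\<close> nor \<open>- a\<close> belongs to \<open>Q\<close>, then
\<open>-1 = t + k a\<close> and \<open>-1 = s - l a\<close> with \<open>s, t \<in> Q\<close> and \<open>k, l \<in> S\<close>.
Eliminating \<open>a\<close> shows \<open>- k \<in> Q\<close>; as \<open>k (norm a + a)\<close> is positive, \<open>k
a\<close> and finally \<open>-1\<close> belong to \<open>Q\<close>.\<close>

lemma maximal_cone:
  fixes V S Q0 :: "'a::cstar_algebra set"
  assumes V: "subspace V" "1 \<in> V" "\<And>x. x \<in> V \<Longrightarrow> star x = x"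
    and S_sub: "\<And>k. k \<in> S \<Longrightarrow> k \<in> V \<and> is_positive k"
    and S_add: "\<And>k l. k \<in> S \<Longrightarrow> l \<in> S \<Longrightarrow> k + l \<in> S"
    and S_mult: "\<And>k l. k \<in> S \<Longrightarrow> l \<in> S \<Longrightarrow> k * l \<in> S"
    and S_of_real: "\<And>r. 0 \<le> r \<Longrightarrow> of_real r \<in> S"
    and S_V: "\<And>k a. k \<in> S \<Longrightarrow> a \<in> V \<Longrightarrow> k * a \<in> V \<and> k * a = a * k"
    and Q0_sub: "Q0 \<subseteq> V"
    and Q0_add: "\<And>x y. x \<in> Q0 \<Longrightarrow> y \<in> Q0 \<Longrightarrow> x + y \<in> Q0"
    and Q0_mult: "\<And>k x. k \<in> S \<Longrightarrow> x \<in> Q0 \<Longrightarrow> k * x \<in> Q0"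
    and Q0_positive: "\<And>x. x \<in> V \<Longrightarrow> is_positive x \<Longrightarrow> x \<in> Q0"
    and Q0_proper: "- 1 \<notin> Q0"
  obtains Q where "total_cone V Q" "Q0 \<subseteq> Q" "\<And>k x. k \<in> S \<Longrightarrow> x \<in> Q \<Longrightarrow> k * x \<in> Q"
proof -
  define ok where "ok Q \<longleftrightarrow> Q0 \<subseteq> Q \<and> Q \<subseteq> V \<and> (\<forall>x\<in>Q. \<forall>y\<in>Q. x + y \<in> Q) \<and>
    (\<forall>k\<in>S. \<forall>x\<in>Q. k * x \<in> Q) \<and> - 1 \<notin> Q" for Q
  have "ok Q0" using assms by (auto simp: ok_def)
  have "\<exists>M\<in>{Q. ok Q}. \<forall>X\<in>{Q. ok Q}. M \<subseteq> X \<longrightarrow> X = M"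
  proof (rule subset_Zorn_nonempty)
    show "{Q. ok Q} \<noteq> {}" using \<open>ok Q0\<close> by blast
    fix C assume C: "C \<noteq> {}" "subset.chain {Q. ok Q} C"
    have ok: "ok X" if "X \<in> C" for X using C(2) that by (auto simp: subset.chain_def)
    have "x + y \<in> \<Union>C" if "x \<in> X" "X \<in> C" "y \<in> Y" "Y \<in> C" for x y X Y
    proof -
      have "X \<subseteq> Y \<or> Y \<subseteq> X" using C(2) that by (auto simp: subset.chain_def)
      thus ?thesis using ok[OF that(2)] ok[OF that(4)] that unfolding ok_def by blast
    qed
    hence "\<forall>x\<in>\<Union>C. \<forall>y\<in>\<Union>C. x + y \<in> \<Union>C" by blast
    moreover have "Q0 \<subseteq> \<Union>C" "\<Union>C \<subseteq> V" "\<forall>k\<in>S. \<forall>x\<in>\<Union>C. k * x \<in> \<Union>C" "- 1 \<notin> \<Union>C"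
      using ok C(1) unfolding ok_def by blast+
    ultimately show "\<Union>C \<in> {Q. ok Q}" by (simp add: ok_def)
  qed
  then obtain Q where Q: "ok Q" and max: "\<And>X. ok X \<Longrightarrow> Q \<subseteq> X \<Longrightarrow> X = Q" by blast
  have Q_sub: "Q \<subseteq> V" and Q0Q: "Q0 \<subseteq> Q" and add: "\<And>x y. x \<in> Q \<Longrightarrow> y \<in> Q \<Longrightarrow> x + y \<in> Q"
    and mult: "\<And>k x. k \<in> S \<Longrightarrow> x \<in> Q \<Longrightarrow> k * x \<in> Q" and proper: "- 1 \<notin> Q"
    using Q by (auto simp: ok_def)
  have pos: "x \<in> Q" if "x \<in> V" "is_positive x" for x using Q0Q Q0_positive that by blast
  have S0: "0 \<in> S" and S1: "1 \<in> S" using S_of_real[of 0] S_of_real[of 1] by auto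
  have Q_0: "0 \<in> Q" using pos[of 0] subspace_0[OF V(1)] by simp
  have Q_1: "1 \<in> Q" using pos[of 1] V(2) by simp
  have ext: "\<exists>t\<in>Q. \<exists>k\<in>S. - 1 = t + k * a" if a: "a \<in> V" "a \<notin> Q" for a
  proof (rule ccontr)
    assume neg: "\<not> ?thesis"
    define X where "X = {t + k * a | t k. t \<in> Q \<and> k \<in> S}"
    have "Q \<subseteq> X" unfolding X_def using S0 by force
    moreover have "ok X"
      unfolding ok_def
    proof (intro conjI ballI)
      show "Q0 \<subseteq> X" using Q0Q \<open>Q \<subseteq> X\<close> by blast
      show "X \<subseteq> V" using Q_sub S_V a(1) V(1) by (auto simp: X_def intro!: subspace_add)
      show "- 1 \<notin> X" using neg by (auto simp: X_def)
      fix x assume "x \<in> X"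
      then obtain t k where x: "x = t + k * a" "t \<in> Q" "k \<in> S" by (auto simp: X_def)
      { fix y assume "y \<in> X"
        then obtain u l where y: "y = u + l * a" "u \<in> Q" "l \<in> S" by (auto simp: X_def)
        have "x + y = (t + u) + (k + l) * a" by (simp add: x y algebra_simps)
        thus "x + y \<in> X" unfolding X_def using x y add S_add by blast }
      { fix l assume "l \<in> S"
        have "l * x = l * t + (l * k) * a" by (simp add: x algebra_simps)
        thus "l * x \<in> X" unfolding X_def using x \<open>l \<in> S\<close> mult S_mult by blast }
    qed
    ultimately have "X = Q" using max by blast
    moreover have "a \<in> X" unfolding X_def using Q_0 S1 by force
    ultimately show False using a(2) by simp
  qed
  have "total_cone V Q"
  proof (unfold_locales, fact V(1), fact V(2), fact V(3), fact Q_sub, fact add)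
    show "r *\<^sub>R x \<in> Q" if "0 \<le> r" "x \<in> Q" for r x
      using mult[OF S_of_real[OF that(1)] that(2)] by (simp add: of_real_def)
    show "a \<in> Q \<or> - a \<in> Q" if a: "a \<in> V" for a
    proof (rule ccontr)
      assume n: "\<not> (a \<in> Q \<or> - a \<in> Q)"
      from ext[OF a] n obtain t k where tk: "t \<in> Q" "k \<in> S" "- 1 = t + k * a" by blast
      from ext[of "- a"] n a V(1) obtain s l where sl: "s \<in> Q" "l \<in> S" "- 1 = s + l * (- a)"
        by (auto simp: subspace_neg)
      have la: "- (k * a) = 1 + t" using tk(3) by (simp add: algebra_simps minus_equation_iff eq_neg_iff_add_eq_0)
      have kl: "k * l = l * k" using S_V tk(2) sl(2) S_sub by blast
      have "- k = k * (s + l * (- a))" using sl(3) by (metis mult_minus1_right)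
      also have "\<dots> = k * s + l * (- (k * a))" using kl by (simp add: algebra_simps flip: mult.assoc)
      also have "\<dots> = k * s + (l * 1 + l * t)" by (simp add: la algebra_simps)
      also have "\<dots> \<in> Q" using tk sl Q_1 by (intro add mult) auto
      finally have mk: "- k \<in> Q" .
      have "is_positive (k * (of_real (norm a) + a))"
        using S_V tk(2) a V(1,2) of_real_commute S_sub
        by (intro positive_mult_commuting positive_norm_plus V(3)) (auto simp: algebra_simps of_real_commute)
      moreover have "k * (of_real (norm a) + a) \<in> V"
        using S_V[OF tk(2)] a V(1,2) by (auto simp: of_real_def intro!: subspace_add subspace_mul)
      ultimately have "k * (of_real (norm a) + a) \<in> Q" by (rule pos[rotated])
      moreover have "of_real (norm a) * (- k) \<in> Q" by (intro mult S_of_real mk) simp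
      ultimately have "k * (of_real (norm a) + a) + of_real (norm a) * (- k) \<in> Q" by (rule add)
      also have "k * (of_real (norm a) + a) + of_real (norm a) * (- k) = k * a"
        by (simp add: algebra_simps of_real_def)
      finally show False using add[OF tk(1)] tk(3) proper by metis
    qed
  qed (use pos proper in auto)
  thus thesis using that Q0Q mult by blast
qed

section \<open>States and characters\<close>

lemma re_im_part_unique:
  assumes "star u = u" "star v = (v::'a::cstar_algebra)"
  shows "re_part (u + \<i> *\<^sub>C v) = u" "im_part (u + \<i> *\<^sub>C v) = v"
proof -
  have s: "star (u + \<i> *\<^sub>C v) = u - \<i> *\<^sub>C v"
    using assms by (simp add: star_add star_scaleC scaleC_minus_left)
  show "re_part (u + \<i> *\<^sub>C v) = u" unfolding re_part_def s by (simp flip: scaleR_2)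
  have "\<i> *\<^sub>C (u - \<i> *\<^sub>C v - (u + \<i> *\<^sub>C v)) = v + v"
    by (simp add: scaleC_diff_right scaleC_add_right ii_scaleC_ii)
  thus "im_part (u + \<i> *\<^sub>C v) = v" unfolding im_part_def s by (simp flip: scaleR_2)
qed

lemma re_part_self_adjoint: "star u = u \<Longrightarrow> re_part u = u" and im_part_self_adjoint: "star u = u \<Longrightarrow> im_part u = 0"
  using re_im_part_unique[of u 0] by auto

text \<open>The complex-linear extension of a functional on the self-adjoint part.\<close>

definition complexify :: "('a::cstar_algebra \<Rightarrow> real) \<Rightarrow> 'a \<Rightarrow> complex" where
  "complexify f x = Complex (f (re_part x)) (f (im_part x))"

lemma csubspace_subspace: "csubspace B \<Longrightarrow> subspace (B::'a::cstar_algebra set)"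
  by (auto simp: subspace_def complex_vector.subspace_def scaleR_scaleC)

lemma re_im_part_mem:
  assumes "csubspace B" "\<And>x. x \<in> B \<Longrightarrow> star x \<in> B" "x \<in> B"
  shows "re_part x \<in> B" "im_part x \<in> B"
  using assms csubspace_subspace[OF assms(1)] unfolding re_part_def im_part_def
  by (auto intro!: subspace_mul subspace_add complex_vector.subspace_scale complex_vector.subspace_diff)

lemma complexify_clinear:
  assumes B: "csubspace B" "\<And>x. x \<in> B \<Longrightarrow> star x \<in> B"
    and f: "\<And>u v. u \<in> B \<Longrightarrow> v \<in> B \<Longrightarrow> star u = u \<Longrightarrow> star v = v \<Longrightarrow> f (u + v) = f u + f v"
      "\<And>r u. u \<in> B \<Longrightarrow> star u = u \<Longrightarrow> f (r *\<^sub>R u) = r * f u"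
  shows "clinear_on B (complexify f)"
  unfolding clinear_on_def
proof (intro conjI ballI allI)
  have mem: "re_part y \<in> B" "im_part y \<in> B" if "y \<in> B" for y using re_im_part_mem[of B y] B that by auto
  fix x assume x: "x \<in> B"
  { fix y assume y: "y \<in> B"
    have "x + y = (re_part x + re_part y) + \<i> *\<^sub>C (im_part x + im_part y)"
      by (subst re_im_part[of x], subst re_im_part[of y]) (simp add: scaleC_add_right algebra_simps)
    hence "re_part (x + y) = re_part x + re_part y" "im_part (x + y) = im_part x + im_part y"
      using re_im_part_unique[of "re_part x + re_part y" "im_part x + im_part y"] by (simp_all add: star_add)
    thus "complexify f (x + y) = complexify f x + complexify f y"
      using mem x y by (simp add: complexify_def f complex_eq_iff) }
  fix c :: complex
  let ?u = "Re c *\<^sub>R re_part x + (- Im c) *\<^sub>R im_part x" and ?v = "Re c *\<^sub>R im_part x + Im c *\<^sub>R re_part x"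
  have "c *\<^sub>C x = (complex_of_real (Re c) + \<i> * complex_of_real (Im c)) *\<^sub>C (re_part x + \<i> *\<^sub>C im_part x)"
    by (subst re_im_part[of x]) (simp flip: complex_eq)
  also have "\<dots> = ?u + \<i> *\<^sub>C ?v"
    by (simp add: scaleR_scaleC scaleC_add_left scaleC_add_right scaleC_scaleC scaleC_minus_left algebra_simps)
  finally have e: "c *\<^sub>C x = ?u + \<i> *\<^sub>C ?v" .
  have "re_part (c *\<^sub>C x) = ?u" "im_part (c *\<^sub>C x) = ?v"
    unfolding e by (intro re_im_part_unique; simp add: star_add star_scaleR star_diff)+
  moreover have lin: "f (p *\<^sub>R u + q *\<^sub>R v) = p * f u + q * f v"
    if "u \<in> B" "v \<in> B" "star u = u" "star v = v" for p q u v
    using that csubspace_subspace[OF B(1)] by (subst f(1)) (auto simp: f(2) star_scaleR intro: subspace_mul)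
  have "f ?u = Re c * f (re_part x) - Im c * f (im_part x)" "f ?v = Re c * f (im_part x) + Im c * f (re_part x)"
    using lin[of "re_part x" "im_part x" "Re c" "- Im c"] lin[of "im_part x" "re_part x" "Re c" "Im c"] mem[OF x] by simp_all
  ultimately show "complexify f (c *\<^sub>C x) = c *\<^sub>C complexify f x"
    by (simp add: complexify_def scaleC_complex_def complex_eq_iff)
qed

locale unital_cstar_subalgebra =
  fixes D :: "'a::cstar_algebra set"
  assumes D: "cstar_subalgebra D" "1 \<in> D"
begin

lemma csubspace: "csubspace D" and closed: "closed D"
  and mult [intro, simp]: "x \<in> D \<Longrightarrow> y \<in> D \<Longrightarrow> x * y \<in> D"
  and star_mem [intro, simp]: "x \<in> D \<Longrightarrow> star x \<in> D"
  using D by (auto simp: cstar_subalgebra_def closed_subalgebra_def)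

lemma one [intro, simp]: "1 \<in> D" by (rule D)

lemma subspace: "subspace D" using csubspace by (rule csubspace_subspace)

lemma add [intro, simp]: "x \<in> D \<Longrightarrow> y \<in> D \<Longrightarrow> x + y \<in> D"
  and diff [intro, simp]: "x \<in> D \<Longrightarrow> y \<in> D \<Longrightarrow> x - y \<in> D"
  and minus [intro, simp]: "x \<in> D \<Longrightarrow> - x \<in> D"
  and scaleR [intro, simp]: "x \<in> D \<Longrightarrow> r *\<^sub>R x \<in> D"
  and scaleC [intro, simp]: "x \<in> D \<Longrightarrow> c *\<^sub>C x \<in> D"
  and zero [intro, simp]: "0 \<in> D"
  and sum [intro, simp]: "(\<And>i. i \<in> I \<Longrightarrow> g i \<in> D) \<Longrightarrow> sum g I \<in> D"
  using subspace csubspace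
  by (auto intro: subspace_add subspace_diff subspace_neg subspace_mul subspace_0 subspace_sum
      complex_vector.subspace_scale)

lemma of_real [intro, simp]: "of_real r \<in> D" by (auto simp: of_real_def)

lemma closed_unital_subalgebra: "closed_unital_subalgebra D"
  by (auto simp: closed_unital_subalgebra_def closed subspace)

lemma re_part_mem [intro, simp]: "x \<in> D \<Longrightarrow> re_part x \<in> D" and im_part_mem [intro, simp]: "x \<in> D \<Longrightarrow> im_part x \<in> D"
  by (auto intro: re_im_part_mem[OF csubspace])

lemma positive_rootE:
  assumes "is_positive a" "a \<in> D"
  obtains r where "r \<in> D" "star r = r" "r * r = a"
  using positive_square_root[OF assms(1)] assms(2) closed_unital_subalgebra positive_star by metis

lemma state_clinear:
  assumes "state_on D g"
  shows "x \<in> D \<Longrightarrow> y \<in> D \<Longrightarrow> g (x + y) = g x + g y" "x \<in> D \<Longrightarrow> g (c *\<^sub>C x) = c * g x"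
    "x \<in> D \<Longrightarrow> g (r *\<^sub>R x) = of_real r * g x" "x \<in> D \<Longrightarrow> g (- x) = - g x"
    "x \<in> D \<Longrightarrow> y \<in> D \<Longrightarrow> g (x - y) = g x - g y" "g (of_real r) = of_real r" "g 0 = 0" "g 1 = 1"
proof -
  show 1: "x \<in> D \<Longrightarrow> y \<in> D \<Longrightarrow> g (x + y) = g x + g y" for x y
    using assms by (simp add: state_on_def clinear_on_def)
  show 2: "x \<in> D \<Longrightarrow> g (c *\<^sub>C x) = c * g x" for x c
    using assms by (simp add: state_on_def clinear_on_def scaleC_complex_def)
  show 3: "x \<in> D \<Longrightarrow> g (r *\<^sub>R x) = of_real r * g x" for x r by (simp add: scaleR_scaleC 2)
  show 4: "x \<in> D \<Longrightarrow> g (- x) = - g x" for x using 3[of x "-1"] by simp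
  show "x \<in> D \<Longrightarrow> y \<in> D \<Longrightarrow> g (x - y) = g x - g y" using 1[of x "-y"] 4[of y] by auto
  show "g 1 = 1" using assms by (simp add: state_on_def)
  thus "g (of_real r) = of_real r" using 3[of 1 r] by (simp add: of_real_def)
  show "g 0 = 0" using 2[of 0 0] by simp
qed

lemma state_positive:
  assumes "state_on D g" "x \<in> D" "is_positive x"
  shows "g x \<in> \<real>\<^sub>\<ge>\<^sub>0"
proof -
  obtain r where "r \<in> D" "star r = r" "r * r = x" using positive_rootE assms by metis
  thus ?thesis using assms(1) by (metis state_on_def)
qed

lemma state_self_adjoint:
  assumes g: "state_on D g" and x: "x \<in> D" "star x = x"
  shows "g x \<in> \<real>"
proof -
  have "g (of_real (norm x) - x) \<in> \<real>\<^sub>\<ge>\<^sub>0"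
    using x by (intro state_positive[OF g] positive_norm_minus) auto
  hence "of_real (norm x) - g x \<in> \<real>" using x state_clinear[OF g] nonneg_Reals_subset_Reals by auto
  from Reals_diff[OF Reals_of_real this, of "norm x"] show ?thesis by simp
qed

lemma state_star:
  assumes g: "state_on D g" and x: "x \<in> D"
  shows "g (star x) = cnj (g x)"
proof -
  have s: "star x = re_part x - \<i> *\<^sub>C im_part x"
    by (subst re_im_part[of x]) (simp add: star_add star_scaleC scaleC_minus_left)
  have r: "cnj (g (re_part x)) = g (re_part x)" "cnj (g (im_part x)) = g (im_part x)"
    using state_self_adjoint[OF g] x by (simp_all add: Reals_cnj_iff)
  have "g (star x) = g (re_part x) - \<i> * g (im_part x)"
    unfolding s using x by (auto simp: state_clinear[OF g])
  moreover have "g x = g (re_part x) + \<i> * g (im_part x)"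
    by (subst re_im_part[of x]) (use x in \<open>auto simp: state_clinear[OF g]\<close>)
  ultimately show ?thesis by (simp add: r)
qed

lemma complexify_state:
  assumes f: "\<And>u v. u \<in> D \<Longrightarrow> v \<in> D \<Longrightarrow> star u = u \<Longrightarrow> star v = v \<Longrightarrow> f (u + v) = f u + f v"
      "\<And>r u. u \<in> D \<Longrightarrow> star u = u \<Longrightarrow> f (r *\<^sub>R u) = r * f u"
    and "\<And>u. u \<in> D \<Longrightarrow> is_positive u \<Longrightarrow> 0 \<le> f u" "f 1 = 1"
  shows "state_on D (complexify f)"
proof -
  have f0: "f 0 = 0" using f(2)[of 0 0] by simp
  have "complexify f (star x * x) \<in> \<real>\<^sub>\<ge>\<^sub>0" if "x \<in> D" for x
    using that assms(3)[of "star x * x"] positive_star_mult_self[of x] f0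
    by (auto simp: complexify_def re_part_self_adjoint im_part_self_adjoint positive_star complex_nonneg_Reals_iff)
  moreover have "complexify f 1 = 1"
    using assms(4) f0 by (simp add: complexify_def re_part_self_adjoint im_part_self_adjoint complex_eq_iff)
  ultimately show ?thesis
    unfolding state_on_def using complexify_clinear[of D f, OF csubspace] f by simp
qed

text \<open>Being a state supplies unitality and compatibility with the involution.\<close>

definition character :: "('a \<Rightarrow> complex) \<Rightarrow> bool" where
  "character \<rho> \<longleftrightarrow> state_on D \<rho> \<and> (\<forall>x\<in>D. \<forall>y\<in>D. \<rho> (x * y) = \<rho> x * \<rho> y)"

text \<open>The state is evaluated at \<open>star w * w\<close> for \<open>w = - t s x + y\<close> with \<open>s = g (star x
* y)\<close>, giving a quadratic in \<open>t\<close> that is nonnegative on the line.\<close>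

lemma state_Cauchy_Schwarz:
  assumes g: "state_on D g" and x: "x \<in> D" and y: "y \<in> D"
  shows "(cmod (g (star x * y)))\<^sup>2 \<le> Re (g (star x * x)) * Re (g (star y * y))"
proof -
  define p q s where "p = Re (g (star x * x))" and "q = Re (g (star y * y))" and "s = g (star x * y)"
  have nonneg: "g (star z * z) \<in> \<real>\<^sub>\<ge>\<^sub>0" if "z \<in> D" for z using g that by (simp add: state_on_def)
  have pq: "g (star x * x) = of_real p" "p \<ge> 0" "g (star y * y) = of_real q"
    using nonneg[OF x] nonneg[OF y] by (auto simp: p_def q_def complex_nonneg_Reals_iff complex_eq_iff)
  have s': "g (star y * x) = cnj s"
    using state_star[OF g, of "star x * y"] x y by (simp add: s_def star_mult star_star)
  have quad: "0 \<le> t\<^sup>2 * (cmod s)\<^sup>2 * p - 2 * t * (cmod s)\<^sup>2 + q" for t :: real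
  proof -
    define c where "c = - of_real t * s"
    let ?c = c and ?w = "c *\<^sub>C x + y"
    have "star ?w * ?w = (cnj ?c * ?c) *\<^sub>C (star x * x) + cnj ?c *\<^sub>C (star x * y) + ?c *\<^sub>C (star y * x) + star y * y"
      by (simp add: star_add star_scaleC algebra_simps mult_scaleC_left mult_scaleC_right scaleC_scaleC)
    hence "g (star ?w * ?w) = (cnj ?c * ?c) * of_real p + cnj ?c * s + ?c * cnj s + of_real q"
      using x y by (simp add: state_clinear[OF g] pq s' s_def)
    moreover have "0 \<le> Re (g (star ?w * ?w))"
      using nonneg[of ?w] x y by (simp add: complex_nonneg_Reals_iff)
    ultimately have "0 \<le> Re ((cnj ?c * ?c) * of_real p + cnj ?c * s + ?c * cnj s + of_real q)" by simp
    thus ?thesis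
      unfolding c_def by (subst (1 2) cmod_power2) (simp add: algebra_simps power2_eq_square)
  qed
  have "(cmod s)\<^sup>2 \<le> p * q"
  proof (cases "p = 0")
    case True
    have "s = 0"
    proof (rule ccontr)
      assume "s \<noteq> 0"
      thus False using quad[of "(q + 1) / (2 * (cmod s)\<^sup>2)"] True by (simp add: field_simps)
    qed
    thus ?thesis using True by simp
  next
    case False
    thus ?thesis using quad[of "1 / p"] pq(2) by (simp add: field_simps power2_eq_square)
  qed
  thus ?thesis by (simp add: p_def q_def s_def)
qed

lemma state_null:
  assumes g: "state_on D g" and x: "x \<in> D" "g (star x * x) = 0" and y: "y \<in> D"
  shows "g (star x * y) = 0" "g (star y * x) = 0"
  using state_Cauchy_Schwarz[OF g x(1) y] state_Cauchy_Schwarz[OF g y x(1)] x(2) by simp_all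

text \<open>If a multiplicative state is a proper convex combination of two states, these vanish at \<open>star y * y\<close>
whenever \<open>\<rho> y = 0\<close>, hence at \<open>y\<close>. They therefore have the same kernel as
\<open>\<rho>\<close>.\<close>

lemma character_pure:
  assumes \<rho>: "character \<rho>"
  shows "pure_state_on D \<rho>"
  unfolding pure_state_on_def
proof (intro conjI allI impI)
  show s: "state_on D \<rho>" using \<rho> by (simp add: character_def)
  fix g h t assume a: "state_on D g \<and> state_on D h \<and> 0 < t \<and> t < 1 \<and>
    (\<forall>x\<in>D. \<rho> x = complex_of_real t * g x + complex_of_real (1 - t) * h x)"
  hence g: "state_on D g" and h: "state_on D h" and t: "0 < t" "t < 1" by auto
  show "\<forall>x\<in>D. g x = \<rho> x \<and> h x = \<rho> x"
  proof
    fix x assume x: "x \<in> D"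
    define y where "y = x - \<rho> x *\<^sub>C 1"
    have y: "y \<in> D" using x by (auto simp: y_def)
    have "\<rho> y = 0" using x by (auto simp: y_def state_clinear[OF s])
    hence "\<rho> (star y * y) = 0" using \<rho> y by (auto simp: character_def)
    hence e: "complex_of_real t * g (star y * y) + complex_of_real (1 - t) * h (star y * y) = 0"
      using a y by auto
    have "g (star y * y) \<in> \<real>\<^sub>\<ge>\<^sub>0" "h (star y * y) \<in> \<real>\<^sub>\<ge>\<^sub>0"
      using g h y by (auto simp: state_on_def)
    then obtain p q where pq: "g (star y * y) = of_real p" "p \<ge> 0" "h (star y * y) = of_real q" "q \<ge> 0"
      by (auto elim!: nonneg_Reals_cases)
    from e have "t * p + (1 - t) * q = 0" unfolding pq by (metis of_real_add of_real_mult of_real_eq_0_iff)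
    hence "t * p = 0" "(1 - t) * q = 0" using pq t by (auto simp: add_nonneg_eq_0_iff)
    hence "g (star y * y) = 0" "h (star y * y) = 0" using t pq by auto
    hence "g y = 0" "h y = 0" using state_null(2)[OF g y _ one] state_null(2)[OF h y _ one] by simp_all
    thus "g x = \<rho> x \<and> h x = \<rho> x" using x by (auto simp: y_def state_clinear[OF g] state_clinear[OF h])
  qed
qed

end

interpretation whole: unital_cstar_subalgebra "UNIV :: 'a::cstar_algebra set"
  by unfold_locales (auto simp: cstar_subalgebra_def closed_subalgebra_def)

context unital_cstar_subalgebra
begin

text \<open>Hahn-Banach with a prescribed lower bound at \<open>x\<close>. The cone is generated by the positive elements,
the self-adjoint kernel of \<open>\<rho>\<close> and \<open>x - \<epsilon>\<close>. It is proper exactly because every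
majorant \<open>d\<close> of \<open>x\<close> in \<open>D\<close> has \<open>\<rho> d \<ge> \<epsilon>\<close>. The
functional of a maximal cone above it is positive, annihilates the kernel of \<open>\<rho>\<close> and is at least
\<open>\<epsilon>\<close> at \<open>x\<close>.\<close>

lemma state_extension:
  assumes \<rho>: "state_on D \<rho>" and x: "star x = x"
    and dom: "\<And>d. d \<in> D \<Longrightarrow> star d = d \<Longrightarrow> is_positive (d - x) \<Longrightarrow> \<epsilon> \<le> Re (\<rho> d)"
  obtains g where "state_on UNIV g" "\<And>d. d \<in> D \<Longrightarrow> g d = \<rho> d" "\<epsilon> \<le> Re (g x)"
proof -
  define V where "V = {y::'a. star y = y}"
  define S where "S = {of_real r :: 'a | r. 0 \<le> r}"
  define Q0 where "Q0 = {y. star y = y \<and> (\<exists>d r. d \<in> D \<and> star d = d \<and> \<rho> d = 0 \<and> 0 \<le> r \<and>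
    is_positive (y - d - r *\<^sub>R (x - of_real \<epsilon>)))}"
  note lin = state_clinear[OF \<rho>]
  have V: "subspace V" by (auto simp: V_def subspace_def star_add star_scaleR)
  have Q0I: "y \<in> Q0" if "star y = y" "d \<in> D" "star d = d" "\<rho> d = 0" "0 \<le> r"
    "is_positive (y - d - r *\<^sub>R (x - of_real \<epsilon>))" for y d r using that by (auto simp: Q0_def)
  obtain Q where Q: "total_cone V Q" "Q0 \<subseteq> Q"
  proof (rule maximal_cone[of V S Q0])
    show "k \<in> V \<and> is_positive k" if "k \<in> S" for k using that by (auto simp: S_def V_def positive_of_real_iff)
    show "k + l \<in> S" if "k \<in> S" "l \<in> S" for k l
      using that unfolding S_def by (smt (verit) mem_Collect_eq of_real_add add_nonneg_nonneg)
    show "k * l \<in> S" if "k \<in> S" "l \<in> S" for k l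
      using that unfolding S_def by (smt (verit) mem_Collect_eq of_real_mult mult_nonneg_nonneg)
    show "k * a \<in> V \<and> k * a = a * k" if "k \<in> S" "a \<in> V" for k a
      using that by (auto simp: S_def V_def star_mult of_real_commute)
    show "y + z \<in> Q0" if "y \<in> Q0" "z \<in> Q0" for y z
    proof -
      from that obtain d r where y: "star y = y" "d \<in> D" "star d = d" "\<rho> d = 0" "0 \<le> r"
        "is_positive (y - d - r *\<^sub>R (x - of_real \<epsilon>))" by (auto simp: Q0_def)
      from that obtain e s where z: "star z = z" "e \<in> D" "star e = e" "\<rho> e = 0" "0 \<le> s"
        "is_positive (z - e - s *\<^sub>R (x - of_real \<epsilon>))" by (auto simp: Q0_def)
      have "is_positive ((y + z) - (d + e) - (r + s) *\<^sub>R (x - of_real \<epsilon>))"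
        using positive_add[OF y(6) z(6)] by (simp add: algebra_simps)
      thus ?thesis using y z by (intro Q0I[of _ "d + e" "r + s"]) (auto simp: star_add lin)
    qed
    show "k * y \<in> Q0" if "k \<in> S" "y \<in> Q0" for k y
    proof -
      from that obtain d r where y: "star y = y" "d \<in> D" "star d = d" "\<rho> d = 0" "0 \<le> r"
        "is_positive (y - d - r *\<^sub>R (x - of_real \<epsilon>))" by (auto simp: Q0_def)
      from that obtain s where s: "k = of_real s" "s \<ge> 0" by (auto simp: S_def)
      have "is_positive (s *\<^sub>R y - s *\<^sub>R d - (s * r) *\<^sub>R (x - of_real \<epsilon>))"
        using positive_scaleR[OF y(6) s(2)] by (simp add: algebra_simps)
      hence "s *\<^sub>R y \<in> Q0" using y s by (intro Q0I[of _ "s *\<^sub>R d" "s * r"]) (auto simp: star_scaleR lin)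
      thus ?thesis by (simp add: s of_real_def)
    qed
    show "y \<in> Q0" if "y \<in> V" "is_positive y" for y
      using that by (intro Q0I[of _ 0 0]) (auto simp: V_def lin)
    show "- 1 \<notin> Q0"
    proof
      assume "- 1 \<in> Q0"
      then obtain d r where d: "d \<in> D" "star d = d" "\<rho> d = 0" "0 \<le> r"
        "is_positive (- 1 - d - r *\<^sub>R (x - of_real \<epsilon>))" by (auto simp: Q0_def)
      show False
      proof (cases "r = 0")
        case True
        hence "\<rho> (- 1 - d) \<in> \<real>\<^sub>\<ge>\<^sub>0" using d by (intro state_positive[OF \<rho>]) auto
        thus False using d by (auto simp: lin complex_nonneg_Reals_iff)
      next
        case False
        \<comment> \<open>solving the assumed relation for \<open>x\<close> exhibits a majorant whose value is only \<open>\<epsilon> - 1 / r\<close>\<close>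
        define e where "e = of_real (\<epsilon> - 1 / r) - (1 / r) *\<^sub>R d"
        have "e - x = (1 / r) *\<^sub>R (- 1 - d - r *\<^sub>R (x - of_real \<epsilon>))"
          using False by (simp add: e_def algebra_simps of_real_def)
        hence "is_positive (e - x)" using positive_scaleR[OF d(5)] d(4) by simp
        moreover have "e \<in> D" "star e = e" using d by (auto simp: e_def star_diff star_scaleR simp del: of_real_diff)
        ultimately have "\<epsilon> \<le> Re (\<rho> e)" by (intro dom)
        also have "\<rho> e = of_real (\<epsilon> - 1 / r)" unfolding e_def using d by (subst lin(5)) (auto simp: lin simp del: of_real_diff)
        finally show False using False d(4) by simp
      qed
    qed
  qed (use V in \<open>auto simp: V_def S_def Q0_def\<close>)
  interpret total_cone V Q by fact
  define g where "g = complexify functional"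
  have g: "state_on UNIV g"
    unfolding g_def
  proof (rule whole.complexify_state)
    show "functional 1 = 1" using functional_of_real[of 1] by simp
    show "0 \<le> functional u" if "is_positive u" for u
      using that functional_nonneg Q_positive positive_star[OF that] by (simp add: V_def)
  qed (auto simp: functional_add functional_scaleR V_def)
  have fg: "g u = of_real (functional u)" if "star u = u" for u
    using that functional_of_real[of 0] by (simp add: g_def complexify_def re_part_self_adjoint im_part_self_adjoint complex_eq_iff)
  have null: "functional d = 0" if "d \<in> D" "star d = d" "\<rho> d = 0" for d
  proof -
    have "d \<in> Q0" "- d \<in> Q0" using that Q0I[of d d 0] Q0I[of "-d" "-d" 0] by (simp_all add: lin)
    hence "0 \<le> functional d" "0 \<le> functional (- d)" using Q functional_nonneg by auto
    moreover have "functional (- d) = - functional d" using functional_scaleR[of d "-1"] that by (simp add: V_def)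
    ultimately show ?thesis by simp
  qed
  have sa: "g d = \<rho> d" if d: "d \<in> D" "star d = d" for d
  proof -
    have "\<rho> d \<in> \<real>" using state_self_adjoint[OF \<rho>] d by auto
    then obtain r where r: "\<rho> d = of_real r" by (auto elim: Reals_cases)
    have "functional (d - of_real r) = 0" using d r by (intro null) (auto simp: star_diff lin)
    hence "functional ((d - of_real r) + of_real r) = r"
      using d functional_of_real[of r] by (subst functional_add) (auto simp: V_def star_diff)
    thus ?thesis using fg[OF d(2)] r by simp
  qed
  have "g d = \<rho> d" if d: "d \<in> D" for d
  proof -
    have "g d = g (re_part d) + \<i> * g (im_part d)"
      by (subst re_im_part[of d]) (simp add: whole.state_clinear[OF g])
    also have "\<dots> = \<rho> (re_part d) + \<i> * \<rho> (im_part d)" using d by (auto simp: sa)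
    also have "\<dots> = \<rho> d"
      by (subst (3) re_im_part[of d]) (use d in \<open>auto simp: lin\<close>)
    finally show ?thesis .
  qed
  moreover have "\<epsilon> \<le> Re (g x)"
  proof -
    have "x - of_real \<epsilon> \<in> Q0" using x by (intro Q0I[of _ 0 1]) (auto simp: star_diff lin)
    hence "0 \<le> functional (x - of_real \<epsilon>)" using Q functional_nonneg by auto
    moreover have "functional ((x - of_real \<epsilon>) + of_real \<epsilon>) = functional (x - of_real \<epsilon>) + \<epsilon>"
      using x functional_of_real[of \<epsilon>] by (subst functional_add) (auto simp: V_def star_diff)
    ultimately show ?thesis using fg[OF x] by simp
  qed
  ultimately show thesis using that g by blast
qed

end

section \<open>Characters of an abelian subalgebra\<close>

lemma positive_conjugate:
  assumes "is_positive a" shows "is_positive (star h * a * (h::'a::cstar_algebra))"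
proof -
  obtain r where r: "is_positive r" "r * r = a" using positive_square_root[OF assms] by metis
  have "star h * a * h = star (r * h) * (r * h)"
    using r positive_star[OF r(1)] by (simp add: star_mult mult.assoc flip: r(2))
  thus ?thesis by (simp add: positive_star_mult_self)
qed

locale abelian_unital_cstar_subalgebra = unital_cstar_subalgebra +
  assumes commute: "\<And>x y. x \<in> D \<Longrightarrow> y \<in> D \<Longrightarrow> x * y = y * x"
begin

lemma positive_mult: "x \<in> D \<Longrightarrow> y \<in> D \<Longrightarrow> is_positive x \<Longrightarrow> is_positive y \<Longrightarrow> is_positive (x * y)"
  by (intro positive_mult_commuting commute)

text \<open>A Positivstellensatz: either some character is nonnegative at all \<open>t i\<close>, or a finite combination of
them with positive coefficients witnesses that this is impossible. The set \<open>Q0\<close> is the cone generated by the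
\<open>t i\<close> over the positive elements; if it is proper, a maximal cone above it that is stable under multiplication
by positive elements gives a functional \<open>f\<close>. Its multiplicativity reduces by translation and polarization to
\<open>f (b\<^sup>2) = 0\<close> when \<open>f b = 0\<close>.\<close>

lemma character_exists:
  fixes t :: "'i \<Rightarrow> 'a" and I :: "'i set"
  assumes t: "\<And>i. i \<in> I \<Longrightarrow> t i \<in> D \<and> star (t i) = t i"
    and no: "\<And>F p. finite F \<Longrightarrow> F \<subseteq> I \<Longrightarrow> (\<And>i. p i \<in> D \<and> is_positive (p i)) \<Longrightarrow>
      \<not> is_positive (- 1 - (\<Sum>i\<in>F. p i * t i))"
  obtains \<rho> where "character \<rho>" "\<And>i. i \<in> I \<Longrightarrow> 0 \<le> Re (\<rho> (t i))"
proof -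
  define V where "V = {d\<in>D. star d = d}"
  define S where "S = {d\<in>D. is_positive d}"
  define Q0 where "Q0 = {x\<in>V. \<exists>F p. finite F \<and> F \<subseteq> I \<and> (\<forall>i. p i \<in> S) \<and> (\<forall>i. i \<notin> F \<longrightarrow> p i = 0) \<and>
    is_positive (x - (\<Sum>i\<in>F. p i * t i))}"
  have V: "subspace V" by (auto simp: V_def subspace_def star_add star_scaleR)
  obtain Q where Q: "total_cone V Q" "Q0 \<subseteq> Q" and Q_mult: "\<And>k x. k \<in> S \<Longrightarrow> x \<in> Q \<Longrightarrow> k * x \<in> Q"
  proof (rule maximal_cone[of V S Q0])
    show "k \<in> V \<and> is_positive k" if "k \<in> S" for k using that by (auto simp: S_def V_def positive_star)
    show "k + l \<in> S" if "k \<in> S" "l \<in> S" for k l using that by (auto simp: S_def positive_add)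
    show "k * l \<in> S" if "k \<in> S" "l \<in> S" for k l using that by (auto simp: S_def positive_mult)
    show "k * a \<in> V \<and> k * a = a * k" if "k \<in> S" "a \<in> V" for k a
      using that commute[of k a] by (auto simp: S_def V_def star_mult positive_star)
    show "x + y \<in> Q0" if "x \<in> Q0" "y \<in> Q0" for x y
    proof -
      from that(1) obtain F p where x: "x \<in> V" "finite F" "F \<subseteq> I" "\<forall>i. p i \<in> S" "\<forall>i. i \<notin> F \<longrightarrow> p i = 0"
        "is_positive (x - (\<Sum>i\<in>F. p i * t i))" by (auto simp: Q0_def)
      from that(2) obtain G q where y: "y \<in> V" "finite G" "G \<subseteq> I" "\<forall>i. q i \<in> S" "\<forall>i. i \<notin> G \<longrightarrow> q i = 0"
        "is_positive (y - (\<Sum>i\<in>G. q i * t i))" by (auto simp: Q0_def)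
      have "(\<Sum>i\<in>F. p i * t i) = (\<Sum>i\<in>F\<union>G. p i * t i)" "(\<Sum>i\<in>G. q i * t i) = (\<Sum>i\<in>F\<union>G. q i * t i)"
        using x y by (auto intro!: sum.mono_neutral_left)
      hence "(x + y) - (\<Sum>i\<in>F\<union>G. (p i + q i) * t i) = (x - (\<Sum>i\<in>F. p i * t i)) + (y - (\<Sum>i\<in>G. q i * t i))"
        by (simp add: distrib_right sum.distrib)
      hence "is_positive ((x + y) - (\<Sum>i\<in>F\<union>G. (p i + q i) * t i))" using positive_add[OF x(6) y(6)] by (simp only:)
      moreover have "x + y \<in> V" using x y by (auto simp: V_def star_add)
      moreover have "\<forall>i. p i + q i \<in> S" using x(4) y(4) by (auto simp: S_def positive_add)
      ultimately show ?thesis unfolding Q0_def using x y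
        by (intro CollectI conjI exI[of _ "F \<union> G"] exI[of _ "\<lambda>i. p i + q i"]) auto
    qed
    show "k * x \<in> Q0" if "k \<in> S" "x \<in> Q0" for k x
    proof -
      from that(2) obtain F p where x: "x \<in> V" "finite F" "F \<subseteq> I" "\<forall>i. p i \<in> S" "\<forall>i. i \<notin> F \<longrightarrow> p i = 0"
        "is_positive (x - (\<Sum>i\<in>F. p i * t i))" by (auto simp: Q0_def)
      have k: "k \<in> D" "is_positive k" using that by (auto simp: S_def)
      have "is_positive (k * (x - (\<Sum>i\<in>F. p i * t i)))"
        using k x t by (intro positive_mult) (auto simp: V_def S_def intro!: diff sum mult)
      hence "is_positive (k * x - (\<Sum>i\<in>F. (k * p i) * t i))"
        by (simp add: right_diff_distrib sum_distrib_left mult.assoc)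
      moreover have "k * x \<in> V" using k x commute[of k x] by (auto simp: V_def star_mult positive_star)
      moreover have "\<forall>i. k * p i \<in> S" using x(4) k by (auto simp: S_def positive_mult)
      ultimately show ?thesis unfolding Q0_def using x
        by (intro CollectI conjI exI[of _ F] exI[of _ "\<lambda>i. k * p i"]) auto
    qed
    show "x \<in> Q0" if "x \<in> V" "is_positive x" for x
      unfolding Q0_def using that
      by (intro CollectI conjI exI[of _ "{}"] exI[of _ "\<lambda>_. 0"]) (auto simp: S_def)
    show "- 1 \<notin> Q0"
      using no by (auto simp: Q0_def S_def)
    show "Q0 \<subseteq> V" by (auto simp: Q0_def)
  qed (use V in \<open>auto simp: V_def S_def positive_of_real_iff\<close>)
  interpret total_cone V Q by fact
  let ?f = functional
  have f_sq0: "?f (b * b) = 0" if b: "b \<in> V" "?f b = 0" for b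
  proof (rule functional_eqI, unfold cut_def, intro allI impI conjI)
    fix e :: real assume e: "e > 0"
    have bD: "b \<in> D" "star b = b" using b by (auto simp: V_def)
    have "is_positive (of_real e + b * b)" using e bD(2)
      by (intro positive_add positive_self_adjoint_square) (auto simp: positive_of_real_iff)
    moreover have "of_real e + b * b \<in> V" using bD by (auto simp: V_def star_add star_mult)
    ultimately show "b * b - of_real (0 - e) \<in> Q" using Q_positive by (simp add: add.commute)
    \<comment> \<open>squares map \<open>Q\<close> into itself, so \<open>(c - b)\<^sup>2 (c + b) + (c + b)\<^sup>2 (c - b)\<close>, which equals
      \<open>2 c (c\<^sup>2 - b\<^sup>2)\<close>, lies in \<open>Q\<close>; the choice \<open>c\<^sup>2 = e\<close> then bounds \<open>b\<^sup>2\<close> by \<open>e\<close>\<close>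
    define s where "s = sqrt e"
    have s: "s > 0" "s * s = e" using e by (auto simp: s_def)
    define c where "c = (of_real s :: 'a)"
    have cb: "c * b = b * c" by (simp add: c_def of_real_commute)
    have cp: "c + b \<in> Q" and cm: "c - b \<in> Q"
      using cut_functional[OF b(1)] s(1) by (auto simp: b cut_def c_def add.commute)
    have sqS: "z * z \<in> S" if "z \<in> V" for z
      using that by (auto simp: S_def V_def positive_self_adjoint_square)
    have cV: "c \<in> V" by (simp add: c_def of_real_V)
    have "c - b \<in> V" "c + b \<in> V" using cV b(1) V by (auto intro: subspace_add subspace_diff)
    hence "(c - b) * (c - b) * (c + b) + (c + b) * (c + b) * (c - b) \<in> Q"
      by (intro Q_add Q_mult sqS cp cm)
    also have "(c - b) * (c - b) * (c + b) + (c + b) * (c + b) * (c - b) = (2 * s) *\<^sub>R (c * c - b * b)"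
    proof -
      have "c * (b * z) = b * (c * z)" for z using cb by (metis mult.assoc)
      hence "(c - b) * (c - b) * (c + b) + (c + b) * (c + b) * (c - b) = 2 *\<^sub>R (c * (c * c - b * b))"
        by (simp add: algebra_simps cb scaleR_2)
      thus ?thesis by (simp add: c_def of_real_def)
    qed
    finally have "(1 / (2 * s)) *\<^sub>R ((2 * s) *\<^sub>R (c * c - b * b)) \<in> Q" by (rule Q_scaleR[rotated]) (use s in simp)
    moreover have "c * c = of_real e" by (simp add: c_def flip: of_real_mult s(2))
    ultimately show "of_real (0 + e) - b * b \<in> Q" using s by simp
  qed
  have VD: "a \<in> V \<longleftrightarrow> a \<in> D \<and> star a = a" for a by (auto simp: V_def)
  have V_mult: "a * b \<in> V" if "a \<in> V" "b \<in> V" for a b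
    using that commute[of a b] by (auto simp: V_def star_mult)
  have V_closed: "a + b \<in> V" "a - b \<in> V" "r *\<^sub>R a \<in> V" if "a \<in> V" "b \<in> V" for a b r
    using that V by (auto intro: subspace_add subspace_diff subspace_mul)
  have f_diff: "?f (a - b) = ?f a - ?f b" if "a \<in> V" "b \<in> V" for a b
    using functional_add[of "a - b" b] that V_closed by simp
  have f_sq: "?f (a * a) = ?f a * ?f a" if a: "a \<in> V" for a
  proof -
    define r where "r = ?f a"
    have "?f ((a - of_real r) * (a - of_real r)) = 0"
      using a by (intro f_sq0 V_closed of_real_V) (simp_all add: f_diff of_real_V functional_of_real r_def)
    also have "(a - of_real r) * (a - of_real r) = a * a - (2 * r) *\<^sub>R a + of_real (r * r)"
      by (simp add: algebra_simps of_real_def flip: scaleR_add_left)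
    also have "?f \<dots> = ?f (a * a) - 2 * r * r + r * r"
      using a V_closed V_mult of_real_V
      by (simp add: functional_add f_diff functional_scaleR functional_of_real r_def del: of_real_mult)
    finally show ?thesis by (simp add: r_def)
  qed
  have f_mult: "?f (a * b) = ?f a * ?f b" if "a \<in> V" "b \<in> V" for a b
  proof -
    have "(a + b) * (a + b) = a * a + 2 *\<^sub>R (a * b) + b * b"
      using that commute[of b a] by (auto simp: V_def algebra_simps scaleR_2)
    hence "?f ((a + b) * (a + b)) = ?f (a * a) + 2 * ?f (a * b) + ?f (b * b)"
      using that V_closed V_mult by (simp add: functional_add functional_scaleR)
    moreover have "?f ((a + b) * (a + b)) = (?f a + ?f b) * (?f a + ?f b)"
      using that V_closed by (simp only: f_sq functional_add)
    ultimately show ?thesis using that by (simp add: f_sq algebra_simps)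
  qed
  define \<rho> where "\<rho> = complexify ?f"
  have \<rho>: "state_on D \<rho>"
    unfolding \<rho>_def
  proof (rule complexify_state)
    show "?f 1 = 1" using functional_of_real[of 1] by simp
    show "0 \<le> ?f u" if "u \<in> D" "is_positive u" for u
      using that by (intro functional_nonneg Q_positive) (auto simp: V_def positive_star)
  qed (auto simp: functional_add functional_scaleR V_def)
  moreover have "\<rho> (x * y) = \<rho> x * \<rho> y" if x: "x \<in> D" and y: "y \<in> D" for x y
  proof -
    define u v p q where "u = re_part x" and "v = im_part x" and "p = re_part y" and "q = im_part y"
    have xy: "x = u + \<i> *\<^sub>C v" "y = p + \<i> *\<^sub>C q" by (simp_all add: u_def v_def p_def q_def flip: re_im_part)
    have mem: "u \<in> V" "v \<in> V" "p \<in> V" "q \<in> V" using x y by (auto simp: u_def v_def p_def q_def V_def)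
    have "x * y = (u * p - v * q) + \<i> *\<^sub>C (u * q + v * p)"
      unfolding xy by (simp add: algebra_simps mult_scaleC_left mult_scaleC_right ii_scaleC_ii scaleC_add_right)
    hence "re_part (x * y) = u * p - v * q" "im_part (x * y) = u * q + v * p"
      using re_im_part_unique[of "u * p - v * q" "u * q + v * p"] V_mult[OF mem(1,3)] V_mult[OF mem(2,4)]
        V_mult[OF mem(1,4)] V_mult[OF mem(2,3)] by (auto simp: VD star_diff star_add)
    thus ?thesis
      using mem V_mult by (simp add: \<rho>_def complexify_def functional_add f_diff f_mult complex_eq_iff
          flip: u_def v_def p_def q_def)
  qed
  ultimately have "character \<rho>" by (simp add: character_def)
  moreover have "0 \<le> Re (\<rho> (t i))" if i: "i \<in> I" for i
  proof -
    have "t i \<in> Q0"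
      unfolding Q0_def using i t[OF i]
      by (intro CollectI conjI exI[of _ "{i}"] exI[of _ "\<lambda>j. if j = i then 1 else 0"])
        (auto simp: S_def V_def)
    hence "0 \<le> ?f (t i)" using Q functional_nonneg by auto
    thus ?thesis using t[OF i] by (simp add: \<rho>_def complexify_def re_part_self_adjoint)
  qed
  ultimately show thesis using that by blast
qed

text \<open>The weights concentrate each \<open>d\<close> on the characters where it is small, so that the weighted sum is at
most \<open>\<epsilon>\<close>. No covering of the character space is chosen: the witness of \<open>character_exists\<close>
for the family \<open>d - \<epsilon>\<close> provides weights \<open>p d\<close> with \<open>\<Sum> p d * (\<epsilon> - d)
\<ge> 1\<close>, and dividing by their sum normalizes them.\<close>

lemma partition_of_unity:
  assumes I: "\<And>d. d \<in> I \<Longrightarrow> d \<in> D \<and> is_positive d" and \<epsilon>: "\<epsilon> > 0"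
    and small: "\<And>\<rho>. character \<rho> \<Longrightarrow> \<exists>d\<in>I. Re (\<rho> d) < \<epsilon>"
  obtains F h where "finite F" "F \<subseteq> I" "\<And>d. d \<in> F \<Longrightarrow> h d \<in> D \<and> star (h d) = h d"
    "(\<Sum>d\<in>F. h d * h d) = 1" "is_positive (of_real \<epsilon> - (\<Sum>d\<in>F. h d * d * h d))"
proof -
  have "\<exists>F p. finite F \<and> F \<subseteq> I \<and> (\<forall>d. p d \<in> D \<and> is_positive (p d)) \<and>
      is_positive (- 1 - (\<Sum>d\<in>F. p d * (d - of_real \<epsilon>)))"
  proof (rule ccontr)
    assume *: "\<not> ?thesis"
    obtain \<rho> where \<rho>: "character \<rho>" "\<And>d. d \<in> I \<Longrightarrow> 0 \<le> Re (\<rho> (d - of_real \<epsilon>))"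
    proof (rule character_exists[of I "\<lambda>d. d - of_real \<epsilon>"])
      show "i - of_real \<epsilon> \<in> D \<and> star (i - of_real \<epsilon>) = i - of_real \<epsilon>" if "i \<in> I" for i
        using I[OF that] by (auto simp: star_diff positive_star)
    qed (use * in blast)+
    have st: "state_on D \<rho>" using \<rho>(1) by (simp add: character_def)
    obtain d where d: "d \<in> I" "Re (\<rho> d) < \<epsilon>" using small[OF \<rho>(1)] by blast
    have "\<rho> (d - of_real \<epsilon>) = \<rho> d - of_real \<epsilon>" using I[OF d(1)] by (simp add: state_clinear[OF st])
    thus False using \<rho>(2)[OF d(1)] d(2) by simp
  qed
  then obtain F p where F: "finite F" "F \<subseteq> I" and p: "\<And>d. p d \<in> D \<and> is_positive (p d)"
    and ineq: "is_positive (- 1 - (\<Sum>d\<in>F. p d * (d - of_real \<epsilon>)))" by blast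
  have FD: "d \<in> D" "is_positive d" if "d \<in> F" for d using that F I by auto
  define q where "q = sum p F"
  define s where "s = (\<Sum>d\<in>F. p d * d)"
  have qD: "q \<in> D" and sD: "s \<in> D" unfolding q_def s_def using p FD by auto
  have "is_positive s" unfolding s_def using p FD by (intro positive_sum positive_mult) auto
  have "- 1 - (\<Sum>d\<in>F. p d * (d - of_real \<epsilon>)) = (\<epsilon> *\<^sub>R q - s) - 1"
    by (simp add: q_def s_def right_diff_distrib sum_subtractf scaleR_sum_right of_real_def)
  with ineq have ineq: "is_positive ((\<epsilon> *\<^sub>R q - s) - 1)" by simp
  from positive_add[OF this \<open>is_positive s\<close>] have "is_positive (\<epsilon> *\<^sub>R q - 1)" by simp
  from positive_scaleR[OF this, of "1 / \<epsilon>"] have "is_positive (q - of_real (1 / \<epsilon>))"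
    using \<epsilon> by (simp add: algebra_simps of_real_def)
  then obtain w where w: "q * w = 1" "w * q = 1" "is_positive w"
    "\<And>B. closed_unital_subalgebra B \<Longrightarrow> q \<in> B \<Longrightarrow> w \<in> B"
    by (rule positive_inverse) (use \<epsilon> in auto)
  have wD: "w \<in> D" using w(4)[OF closed_unital_subalgebra qD] .
  have "\<exists>h. h \<in> D \<and> star h = h \<and> h * h = w * p d" for d
    using positive_rootE[of "w * p d"] positive_mult[of w "p d"] wD w(3) p by blast
  then obtain h where h: "\<And>d. h d \<in> D" "\<And>d. star (h d) = h d" "\<And>d. h d * h d = w * p d" by metis
  have "(\<Sum>d\<in>F. h d * h d) = w * q" by (simp add: h q_def sum_distrib_left)
  hence 1: "(\<Sum>d\<in>F. h d * h d) = 1" by (simp add: w)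
  have "h d * d * h d = w * (p d * d)" if "d \<in> F" for d
  proof -
    have "h d * d * h d = (h d * h d) * d" using commute[OF FD(1)[OF that] h(1)[of d]] by (simp add: mult.assoc)
    thus ?thesis by (simp add: h mult.assoc)
  qed
  hence 2: "(\<Sum>d\<in>F. h d * d * h d) = w * s" by (simp add: s_def sum_distrib_left)
  have "is_positive (w * ((\<epsilon> *\<^sub>R q - s) - 1))" using wD w(3) ineq qD sD by (intro positive_mult) auto
  hence "is_positive (w * ((\<epsilon> *\<^sub>R q - s) - 1) + w)" using w(3) by (rule positive_add)
  also have "w * ((\<epsilon> *\<^sub>R q - s) - 1) + w = of_real \<epsilon> - w * s"
    by (simp add: right_diff_distrib w of_real_def)
  finally have "is_positive (of_real \<epsilon> - (\<Sum>d\<in>F. h d * d * h d))" by (simp add: 2)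
  thus thesis using that[OF F _ 1] h by blast
qed

text \<open>Applied to the single element \<open>star d * d\<close>, a partition of unity bounds that element itself.\<close>

lemma characters_separate:
  assumes d: "d \<in> D" and zero: "\<And>\<rho>. character \<rho> \<Longrightarrow> \<rho> d = 0"
  shows "d = 0"
proof -
  let ?s = "star d * d"
  have sD: "?s \<in> D" using d by simp
  have "norm ?s \<le> \<epsilon>" if pos: "\<epsilon> > 0" for \<epsilon> :: real
  proof -
    obtain F h where F: "finite F" "F \<subseteq> {?s}" "\<And>d. d \<in> F \<Longrightarrow> h d \<in> D \<and> star (h d) = h d"
      "(\<Sum>d\<in>F. h d * h d) = 1" "is_positive (of_real \<epsilon> - (\<Sum>d\<in>F. h d * d * h d))"
    proof (rule partition_of_unity[of "{?s}" \<epsilon>])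
      show "\<exists>d\<in>{?s}. Re (\<rho> d) < \<epsilon>" if "character \<rho>" for \<rho>
        using zero[OF that] that d \<open>\<epsilon> > 0\<close> by (simp add: character_def)
    qed (use sD pos positive_star_mult_self in auto)
    have "(\<Sum>e\<in>F. h e * e * h e) = (\<Sum>e\<in>F. ?s * (h e * h e))"
    proof (rule sum.cong[OF refl])
      fix e assume e: "e \<in> F"
      hence "e = ?s" using F(2) by blast
      moreover have "h e * ?s = ?s * h e" using F(3)[OF e] sD commute by blast
      ultimately show "h e * e * h e = ?s * (h e * h e)" by (simp add: mult.assoc[symmetric])
    qed
    also have "\<dots> = ?s" using F(4) by (simp flip: sum_distrib_left)
    finally have "is_positive (of_real \<epsilon> - ?s)" using F(5) by simp
    moreover have "is_positive (of_real \<epsilon> + ?s)"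
      using pos by (intro positive_add positive_star_mult_self) (simp add: positive_of_real_iff)
    ultimately show ?thesis by (rule norm_le_of_positive)
  qed
  hence "norm ?s \<le> 0" by (rule field_le_epsilon[of _ 0, simplified])
  thus ?thesis using norm_star_mult_self[of d] by simp
qed

end

section \<open>Conditional expectations under the extension property\<close>

lemma state_bound:
  assumes g: "state_on UNIV g"
  shows "Re (g (star x * x)) \<le> (norm x)\<^sup>2"
proof -
  have "g (of_real (norm (star x * x)) - star x * x) \<in> \<real>\<^sub>\<ge>\<^sub>0"
    by (intro whole.state_positive[OF g] positive_norm_minus) (auto simp: star_mult star_star)
  thus ?thesis by (simp add: whole.state_clinear[OF g] complex_nonneg_Reals_iff norm_star_mult_self del: of_real_power)
qed

locale expectation_with_extension_property = abelian_unital_cstar_subalgebra +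
  fixes E
  assumes E: "conditional_expectation D E"
    and unique_extension:
      "\<And>f. pure_state_on D f \<Longrightarrow> \<exists>!g. state_on UNIV g \<and> (\<forall>x\<in>D. g x = f x)"
begin

lemma E_add: "E (x + y) = E x + E y" and E_scaleC: "E (c *\<^sub>C x) = c *\<^sub>C E x"
  and E_mem [simp, intro]: "E x \<in> D" and E_D [simp]: "d \<in> D \<Longrightarrow> E d = d"
  and E_left: "d \<in> D \<Longrightarrow> E (d * x) = d * E x" and E_right: "d \<in> D \<Longrightarrow> E (x * d) = E x * d"
  using E by (auto simp: conditional_expectation_def clinear_on_def)

lemma E_scaleR: "E (r *\<^sub>R x) = r *\<^sub>R E x" by (simp add: scaleR_scaleC E_scaleC)
lemma E_minus: "E (- x) = - E x" using E_scaleR[of "-1" x] by simp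
lemma E_diff: "E (x - y) = E x - E y" using E_add[of x "- y"] by (simp add: E_minus)
lemma E_positive:
  assumes "is_positive x"
  shows "is_positive (E x)"
proof -
  obtain r where r: "is_positive r" "r * r = x" using positive_square_root[OF assms] by metis
  have "\<exists>d\<in>D. E (star r * r) = star d * d" using E by (auto simp: conditional_expectation_def)
  thus ?thesis using r positive_star[OF r(1)] positive_star_mult_self by metis
qed

lemma E_star: "E (star x) = star (E x)"
proof -
  have sa: "star (E u) = E u" if "star u = u" for u
  proof -
    have "star (E (of_real (norm u) - u)) = E (of_real (norm u) - u)"
      by (intro positive_star E_positive positive_norm_minus that)
    thus ?thesis by (simp add: E_diff star_diff)
  qed
  have s: "star x = re_part x - \<i> *\<^sub>C im_part x"
    by (subst re_im_part[of x]) (simp add: star_add star_scaleC scaleC_minus_left)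
  have "star (E x) = star (E (re_part x) + \<i> *\<^sub>C E (im_part x))"
    by (subst re_im_part[of x]) (simp add: E_add E_scaleC)
  thus ?thesis by (simp add: s E_diff E_scaleC star_add star_scaleC sa scaleC_minus_left)
qed

lemma state_E: "state_on D \<rho> \<Longrightarrow> state_on UNIV (\<lambda>x. \<rho> (E x))"
  unfolding state_on_def[of UNIV] clinear_on_def
  by (auto simp: E_add E_scaleC state_clinear scaleC_complex_def
      intro!: state_positive E_positive positive_star_mult_self)

lemma extension_eq:
  assumes "character \<rho>" "state_on UNIV g" "\<And>d. d \<in> D \<Longrightarrow> g d = \<rho> d"
  shows "g x = \<rho> (E x)"
proof -
  have "state_on UNIV (\<lambda>x. \<rho> (E x))" using assms(1) by (auto simp: character_def intro: state_E)
  with unique_extension[OF character_pure[OF assms(1)]] assms(2,3) have "g = (\<lambda>x. \<rho> (E x))"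
    by (metis E_D)
  thus ?thesis by simp
qed

text \<open>Otherwise \<open>\<rho>\<close> would have an extension that is at least \<open>\<epsilon>\<close> at
\<open>x\<close>, whereas the only extension \<open>\<rho> \<circ> E\<close> vanishes there. The majorant is positive because
\<open>E\<close> maps \<open>d - x\<close> to \<open>d\<close>.\<close>

lemma small_majorant:
  assumes \<rho>: "character \<rho>" and x: "star x = x" "E x = 0" and \<epsilon>: "\<epsilon> > 0"
  obtains d where "d \<in> D" "is_positive d" "is_positive (d - x)" "Re (\<rho> d) < \<epsilon>"
proof -
  have st: "state_on D \<rho>" using \<rho> by (simp add: character_def)
  have "\<exists>d. d \<in> D \<and> star d = d \<and> is_positive (d - x) \<and> Re (\<rho> d) < \<epsilon>"
  proof (rule ccontr)
    assume "\<not> ?thesis"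
    hence "\<And>d. d \<in> D \<Longrightarrow> star d = d \<Longrightarrow> is_positive (d - x) \<Longrightarrow> \<epsilon> \<le> Re (\<rho> d)" by force
    then obtain g where g: "state_on UNIV g" "\<And>d. d \<in> D \<Longrightarrow> g d = \<rho> d" "\<epsilon> \<le> Re (g x)"
      using state_extension[of \<rho> x \<epsilon>] st x(1) by blast
    have "g x = \<rho> (E x)" using \<rho> g(1,2) by (rule extension_eq)
    thus False using g(3) \<epsilon> x(2) by (simp add: state_clinear[OF st])
  qed
  then obtain d where d: "d \<in> D" "is_positive (d - x)" "Re (\<rho> d) < \<epsilon>" by blast
  have "is_positive d" using E_positive[OF d(2)] d(1) x(2) by (simp add: E_diff)
  thus thesis using that d by blast
qed

text \<open>Put \<open>y = x - E x\<close>. For each character there is one \<open>d\<close> that is small there and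
dominates the real and imaginary parts of \<open>y\<close> with both signs. Compressing these inequalities by a partition of
unity and summing bounds \<open>\<Sum> h d * y * h d\<close>, and this sum differs from \<open>\<Sum> h d * x * h d\<close>
by \<open>E x\<close>, as \<open>E x\<close> commutes with \<open>D\<close>.\<close>

lemma E_approximation:
  assumes e: "e > 0"
  obtains F :: "'a set" and h :: "'a \<Rightarrow> 'a"
  where "finite F" "\<And>i. i \<in> F \<Longrightarrow> h i \<in> D" "norm ((\<Sum>i\<in>F. h i * x * h i) - E x) < (e::real)"
proof -
  define y where "y = x - E x"
  define \<delta> where "\<delta> = e / 3"
  have \<delta>: "\<delta> > 0" using e by (simp add: \<delta>_def)
  have Ey: "E y = 0" by (simp add: y_def E_diff)
  define u v where "u = re_part y" and "v = im_part y"
  have y_uv: "y = u + \<i> *\<^sub>C v" by (simp add: u_def v_def flip: re_im_part)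
  have uv: "star u = u" "star v = v" by (simp_all add: u_def v_def)
  have Euv: "E u = 0" "E v = 0" by (simp_all add: u_def v_def re_part_def im_part_def E_scaleR E_add E_diff E_scaleC E_star Ey)
  define I where "I = {d\<in>D. is_positive d \<and> is_positive (d - u) \<and> is_positive (d + u) \<and> is_positive (d - v) \<and> is_positive (d + v)}"
  obtain F h where F: "finite F" "F \<subseteq> I" and h: "\<And>d. d \<in> F \<Longrightarrow> h d \<in> D \<and> star (h d) = h d"
    and one: "(\<Sum>d\<in>F. h d * h d) = 1" and bound: "is_positive (of_real \<delta> - (\<Sum>d\<in>F. h d * d * h d))"
  proof (rule partition_of_unity[of I \<delta>])
    show "\<exists>d\<in>I. Re (\<rho> d) < \<delta>" if \<rho>: "character \<rho>" for \<rho>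
    proof -
      have \<delta>4: "\<delta> / 4 > 0" using \<delta> by simp
      obtain a where a: "a \<in> D" "is_positive a" "is_positive (a - u)" "Re (\<rho> a) < \<delta> / 4"
        using small_majorant[OF \<rho> uv(1) Euv(1) \<delta>4] by metis
      obtain b where b: "b \<in> D" "is_positive b" "is_positive (b + u)" "Re (\<rho> b) < \<delta> / 4"
        using small_majorant[OF \<rho> _ _ \<delta>4, of "- u"] uv Euv by (auto simp: E_minus)
      obtain c where c: "c \<in> D" "is_positive c" "is_positive (c - v)" "Re (\<rho> c) < \<delta> / 4"
        using small_majorant[OF \<rho> uv(2) Euv(2) \<delta>4] by metis
      obtain d where d: "d \<in> D" "is_positive d" "is_positive (d + v)" "Re (\<rho> d) < \<delta> / 4"
        using small_majorant[OF \<rho> _ _ \<delta>4, of "- v"] uv Euv by (auto simp: E_minus)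
      have st: "state_on D \<rho>" using \<rho> by (simp add: character_def)
      have "is_positive ((a - u) + b + c + d)" "is_positive (a + (b + u) + c + d)"
        "is_positive (a + b + (c - v) + d)" "is_positive (a + b + c + (d + v))"
        using a b c d by (auto intro!: positive_add)
      hence "a + b + c + d \<in> I"
        using a b c d by (auto simp: I_def algebra_simps intro!: positive_add)
      moreover have "Re (\<rho> (a + b + c + d)) < \<delta>" using a b c d by (simp add: state_clinear[OF st])
      ultimately show ?thesis by blast
    qed
  qed (use \<delta> in \<open>auto simp: I_def\<close>)
  have small: "norm (\<Sum>d\<in>F. h d * z * h d) \<le> \<delta>"
    if z: "\<And>d. d \<in> I \<Longrightarrow> is_positive (d - z) \<and> is_positive (d + z)" for z
  proof (rule norm_le_of_positive)
    have conj: "is_positive (h d * (d - z) * h d)" "is_positive (h d * (d + z) * h d)" if d: "d \<in> F" for d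
      using positive_conjugate[of "d - z" "h d"] positive_conjugate[of "d + z" "h d"] h[OF d] z F(2) d by auto
    have "is_positive ((of_real \<delta> - (\<Sum>d\<in>F. h d * d * h d)) + (\<Sum>d\<in>F. h d * (d - z) * h d))"
      by (intro positive_add bound positive_sum conj)
    thus "is_positive (of_real \<delta> - (\<Sum>d\<in>F. h d * z * h d))"
      by (simp add: algebra_simps sum_subtractf)
    have "is_positive ((of_real \<delta> - (\<Sum>d\<in>F. h d * d * h d)) + (\<Sum>d\<in>F. h d * (d + z) * h d))"
      by (intro positive_add bound positive_sum conj)
    thus "is_positive (of_real \<delta> + (\<Sum>d\<in>F. h d * z * h d))"
      by (simp add: algebra_simps sum.distrib)
  qed
  have "(\<Sum>d\<in>F. h d * x * h d) - E x = (\<Sum>d\<in>F. h d * x * h d) - (\<Sum>d\<in>F. h d * h d) * E x"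
    by (simp add: one)
  also have "\<dots> = (\<Sum>d\<in>F. h d * x * h d - h d * h d * E x)"
    by (simp add: sum_subtractf sum_distrib_right)
  also have "\<dots> = (\<Sum>d\<in>F. h d * y * h d)"
  proof (rule sum.cong[OF refl])
    fix d assume "d \<in> F"
    hence comm: "h d * E x = E x * h d" using h by (intro commute) auto
    have "h d * (E x * h d) = E x * (h d * h d)" by (simp add: comm flip: mult.assoc)
    thus "h d * x * h d - h d * h d * E x = h d * y * h d"
      by (simp add: y_def left_diff_distrib right_diff_distrib mult.assoc comm)
  qed
  also have "\<dots> = (\<Sum>d\<in>F. h d * u * h d) + \<i> *\<^sub>C (\<Sum>d\<in>F. h d * v * h d)"
    by (simp add: y_uv algebra_simps sum.distrib mult_scaleC_left mult_scaleC_right complex_vector.scale_sum_right)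
  finally have "norm ((\<Sum>d\<in>F. h d * x * h d) - E x)
      \<le> norm (\<Sum>d\<in>F. h d * u * h d) + norm (\<i> *\<^sub>C (\<Sum>d\<in>F. h d * v * h d))"
    by (simp only: norm_triangle_ineq)
  also have "\<dots> \<le> \<delta> + \<delta>" using small[of u] small[of v] by (intro add_mono) (auto simp: norm_scaleC I_def)
  also have "\<dots> < e" using e by (simp add: \<delta>_def)
  finally have "norm ((\<Sum>d\<in>F. h d * x * h d) - E x) < e" .
  with F(1) h show thesis by (intro that[of F h]) auto
qed

lemma E_mem_closed:
  assumes "closed M" "\<And>(F :: 'a set) h. finite F \<Longrightarrow> (\<And>i. i \<in> F \<Longrightarrow> h i \<in> D) \<Longrightarrow> (\<Sum>i\<in>F. h i * x * h i) \<in> M"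
  shows "E x \<in> M"
proof -
  have "\<exists>y\<in>M. dist y (E x) < e" if e: "e > 0" for e
  proof -
    show ?thesis
    proof (rule E_approximation[OF e, of x])
      fix F :: "'a set" and h
      assume F: "finite F" "\<And>i. i \<in> F \<Longrightarrow> h i \<in> D" and close: "norm ((\<Sum>i\<in>F. h i * x * h i) - E x) < e"
      thus "\<exists>y\<in>M. dist y (E x) < e"
        using assms(2)[of F h] by (intro bexI[of _ "\<Sum>i\<in>F. h i * x * h i"]) (simp_all add: dist_norm)
    qed
  qed
  thus ?thesis using closed_approachable[OF assms(1)] by blast
qed

section \<open>Normalizers\<close>

lemma normalizer_mem:
  assumes "v \<in> normalizers D"
  shows "d \<in> D \<Longrightarrow> v * d * star v \<in> D" "d \<in> D \<Longrightarrow> star v * d * v \<in> D" "star v * v \<in> D" "v * star v \<in> D"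
proof -
  show *: "v * d * star v \<in> D" "star v * d * v \<in> D" if "d \<in> D" for d
    using assms that by (simp_all add: normalizers_def)
  show "star v * v \<in> D" "v * star v \<in> D" using *[OF one] by simp_all
qed

text \<open>The averages approximating \<open>E (star v * a)\<close> become \<open>\<Sum> (v * h i * star v) * a * h
i\<close> after multiplication by \<open>v\<close>, and \<open>v * h i * star v\<close> lies in \<open>D\<close>.\<close>

lemma bimodule_normalizer:
  assumes M: "closed M" "subspace M" "\<And>d a. d \<in> D \<Longrightarrow> a \<in> M \<Longrightarrow> d * a \<in> M \<and> a * d \<in> M"
    and v: "v \<in> normalizers D" and a: "a \<in> M"
  shows "v * E (star v * a) \<in> M" "E (a * v) * star v \<in> M"
proof -
  have "E (star v * a) \<in> (\<lambda>z. v * z) -` M"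
  proof (rule E_mem_closed)
    show "closed ((\<lambda>z. v * z) -` M)" by (intro closed_vimage[OF M(1)] continuous_intros)
    fix F :: "'a set" and h assume h: "\<And>i. i \<in> F \<Longrightarrow> h i \<in> D"
    have "v * (\<Sum>i\<in>F. h i * (star v * a) * h i) = (\<Sum>i\<in>F. (v * h i * star v) * a * h i)"
      by (simp add: sum_distrib_left mult.assoc)
    also have "\<dots> \<in> M" by (intro subspace_sum M(2) conjunct1[OF M(3)] conjunct2[OF M(3)] normalizer_mem(1)[OF v] h a)
    finally show "(\<Sum>i\<in>F. h i * (star v * a) * h i) \<in> (\<lambda>z. v * z) -` M" by simp
  qed
  thus "v * E (star v * a) \<in> M" by simp
  have "E (a * v) \<in> (\<lambda>z. z * star v) -` M"
  proof (rule E_mem_closed)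
    show "closed ((\<lambda>z. z * star v) -` M)" by (intro closed_vimage[OF M(1)] continuous_intros)
    fix F :: "'a set" and h assume h: "\<And>i. i \<in> F \<Longrightarrow> h i \<in> D"
    have "(\<Sum>i\<in>F. h i * (a * v) * h i) * star v = (\<Sum>i\<in>F. h i * (a * (v * h i * star v)))"
      by (simp add: sum_distrib_right mult.assoc)
    also have "\<dots> \<in> M" by (intro subspace_sum M(2) conjunct1[OF M(3)] conjunct2[OF M(3)] normalizer_mem(1)[OF v] h a)
    finally show "(\<Sum>i\<in>F. h i * (a * v) * h i) \<in> (\<lambda>z. z * star v) -` M" by simp
  qed
  thus "E (a * v) * star v \<in> M" by simp
qed

text \<open>The element \<open>X = v * E (star v * b) * star (E (a * v))\<close> and its adjoint lie in \<open>A\<close>, so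
\<open>X \<in> D\<close> and \<open>X = E X\<close>. Now \<open>E X = E v * E (star v * b) * star (E (a * v))\<close>, and
\<open>E v * E (star v * b) = E (E v * star v * b)\<close> vanishes since \<open>E v * star v \<in> D\<close> and \<open>E b
= 0\<close>. It remains to evaluate \<open>\<rho>\<close> at \<open>star v * X = 0\<close>; if the factor \<open>\<rho> (star
v * v)\<close> is zero, \<open>v\<close> is a null vector and the first coefficient vanishes anyway.\<close>

lemma triangular_coefficients:
  assumes A: "triangular_subalgebra D A" and a: "a \<in> A" and b: "b \<in> A" "E b = 0"
    and v: "v \<in> normalizers D" and \<rho>: "character \<rho>"
  shows "\<rho> (E (star v * b)) = 0 \<or> \<rho> (E (a * v)) = 0"
proof -
  have "closed_subalgebra A" and DA: "D \<subseteq> A" and AA: "A \<inter> star ` A = D"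
    using A by (simp_all add: triangular_subalgebra_def)
  hence "csubspace A" and cl: "closed A" "\<forall>x\<in>A. \<forall>y\<in>A. x * y \<in> A"
    by (simp_all add: closed_subalgebra_def)
  hence sub: "subspace A" by (intro csubspace_subspace)
  define p q where "p = E (star v * b)" and "q = E (a * v)"
  have pq: "p \<in> D" "q \<in> D" by (simp_all add: p_def q_def)
  define X where "X = v * p * star q"
  have bim: "d * x \<in> A \<and> x * d \<in> A" if "d \<in> D" "x \<in> A" for d x
    using cl(2) subsetD[OF DA that(1)] that(2) by blast
  have vp: "v * p \<in> A"
    unfolding p_def using cl(1) sub bim v b(1) by (rule bimodule_normalizer(1))
  have qv: "q * star v \<in> A"
    unfolding q_def using cl(1) sub bim v a by (rule bimodule_normalizer(2))
  have "star X = (q * star p) * star v" by (simp add: X_def star_mult star_star mult.assoc)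
  also have "q * star p = star p * q" using pq by (intro commute) auto
  finally have "star X = star p * (q * star v)" by (simp add: mult.assoc)
  hence "star X \<in> A" using bim[of "star p"] qv pq by simp
  hence "X \<in> star ` A" by (rule image_eqI[rotated]) (simp add: star_star)
  moreover have "X \<in> A" unfolding X_def using bim[of "star q"] vp pq by simp
  ultimately have XD: "X \<in> D" unfolding AA[symmetric] by (rule IntI[rotated])
  \<comment> \<open>\<open>D\<close> is itself a closed \<open>D\<close>-bimodule\<close>
  have "E (1 * v) * star v \<in> D"
    using closed subspace _ v one by (rule bimodule_normalizer(2)) auto
  hence vD: "E v * star v \<in> D" by simp
  have "X = E X" using XD by simp
  also have "\<dots> = E v * p * star q" using pq by (simp add: X_def E_right)
  also have "E v * p = E (E v * star v * b)"
    by (simp add: p_def E_left mult.assoc)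
  also have "\<dots> = E v * star v * E b"
    using vD by (rule E_left)
  also have "\<dots> = 0" by (simp add: b)
  finally have "X = 0" by simp
  hence zero: "star v * v * p * star q = 0" by (simp add: X_def mult.assoc)
  have st: "state_on D \<rho>" and \<rho>mult: "\<And>x y. x \<in> D \<Longrightarrow> y \<in> D \<Longrightarrow> \<rho> (x * y) = \<rho> x * \<rho> y"
    using \<rho> by (auto simp: character_def)
  have "\<rho> (star v * v * p * star q) = \<rho> (star v * v) * \<rho> p * cnj (\<rho> q)"
    using pq normalizer_mem(3)[OF v] by (simp add: \<rho>mult state_star[OF st])
  hence z: "\<rho> (star v * v) * \<rho> p * cnj (\<rho> q) = 0" by (simp add: zero state_clinear[OF st])
  show ?thesis
  proof (cases "\<rho> (star v * v) = 0")
    case True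
    hence "\<rho> (E (star v * v)) = 0" using normalizer_mem(3)[OF v] by simp
    from whole.state_null(1)[OF state_E[OF st] _ this] show ?thesis by simp
  qed (use z in \<open>auto simp: p_def q_def\<close>)
qed

text \<open>As a vector, a normalizer \<open>w\<close> is an eigenvector of \<open>D\<close>, with eigenvalue \<open>\<rho>
(star w * d * w) / \<rho> (star w * w)\<close> for \<open>d\<close>. Stated without the division, this is the image of
\<open>(star w * w) * star w * d = (star w * d * w) * star w\<close>.\<close>

lemma normalizer_eigen:
  assumes w: "w \<in> normalizers D" and d: "d \<in> D" and \<rho>: "character \<rho>"
  shows "\<rho> (star w * w) * \<rho> (E (star w * d * b)) = \<rho> (star w * d * w) * \<rho> (E (star w * b))"
proof -
  have "star w * w * (star w * d * b) = star w * ((w * star w) * d) * b" by (simp add: mult.assoc)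
  also have "(w * star w) * d = d * (w * star w)" using normalizer_mem[OF w] d by (intro commute) auto
  finally have "star w * w * (star w * d * b) = star w * d * w * (star w * b)" by (simp add: mult.assoc)
  hence "star w * w * E (star w * d * b) = star w * d * w * E (star w * b)"
    using normalizer_mem[OF w] d by (simp flip: E_left)
  hence "\<rho> (star w * w * E (star w * d * b)) = \<rho> (star w * d * w * E (star w * b))" by simp
  thus ?thesis using \<rho> normalizer_mem[OF w] d by (simp add: character_def)
qed

text \<open>Since \<open>\<phi> u \<noteq> 0\<close>, comparing the eigenvalues of \<open>u\<close> with \<open>\<phi> (d *
u) = \<rho> d * \<phi> u\<close> shows that \<open>u\<close> fixes \<open>\<rho>\<close>. The vector \<open>y = u - E
u\<close> is orthogonal to \<open>1\<close> and belongs to the same eigenvalues, so for all \<open>c\<close> the vector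
\<open>1 + c y\<close>, normalized, defines a state that extends \<open>\<rho>\<close> and hence coincides with
\<open>\<phi>\<close>. As \<open>\<phi> (star y) = 0\<close>, its value at \<open>star y\<close> is zero for all
\<open>c\<close>, and the coefficient of \<open>c\<close> in this expression is \<open>\<kappa> = \<phi> (star y *
y)\<close>.\<close>

lemma fixing_normalizer:
  assumes u: "u \<in> normalizers D" and \<rho>: "character \<rho>" and nz: "\<rho> (E u) \<noteq> 0"
  shows "\<rho> (E (star (u - E u) * (u - E u))) = 0"
proof -
  have st: "state_on D \<rho>" using \<rho> by (simp add: character_def)
  note lin = state_clinear[OF st] and \<rho>star = state_star[OF st]
  have \<rho>mult: "\<rho> (x * y) = \<rho> x * \<rho> y" if "x \<in> D" "y \<in> D" for x y using \<rho> that by (simp add: character_def)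
  note um = normalizer_mem[OF u]
  define e where "e = E u"
  define y where "y = u - e"
  define \<kappa> where "\<kappa> = \<rho> (E (star y * y))"
  have eD: "e \<in> D" by (simp add: e_def)
  have Ey: "E y = 0" "E (star y) = 0" by (simp_all add: y_def E_diff e_def E_star)
  have fix_char: "\<rho> (star u * d * u) = \<rho> (star u * u) * \<rho> d" if d: "d \<in> D" for d
  proof -
    have "\<rho> (star u * u) * (\<rho> (E (star u)) * \<rho> d) = \<rho> (star u * d * u) * \<rho> (E (star u))"
      using normalizer_eigen[OF u d \<rho>, of 1] d by (simp add: E_right \<rho>mult)
    moreover have "\<rho> (E (star u)) \<noteq> 0" using nz by (simp add: E_star \<rho>star)
    ultimately show ?thesis by simp
  qed
  have yd: "\<rho> (E (star y * d * y)) = \<rho> d * (\<rho> (star u * u) - cnj (\<rho> e) * \<rho> e)" if d: "d \<in> D" for d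
  proof -
    have "star y * d * y = star u * d * u - (star u * (d * e)) - (star e * d) * u + star e * d * e"
      by (simp add: y_def star_diff algebra_simps)
    hence Eyd: "E (star y * d * y) = star u * d * u - star e * (d * e) - (star e * d) * e + star e * d * e"
      using d eD um by (simp add: E_add E_diff E_left E_right E_star flip: e_def)
    show ?thesis
      unfolding Eyd using d eD um(2)[OF d] by (simp add: lin \<rho>mult \<rho>star fix_char) (simp add: algebra_simps)
  qed
  have \<kappa>: "\<rho> (E (star y * d * y)) = \<rho> d * \<kappa>" if "d \<in> D" for d
    using yd[OF that] yd[OF one] by (simp add: \<kappa>_def lin)
  define \<phi> where "\<phi> x = \<rho> (E x)" for x
  have \<phi>: "state_on UNIV \<phi>" unfolding \<phi>_def by (rule state_E[OF st])
  note \<phi>lin = whole.state_clinear[OF \<phi>, simplified]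
  have "\<kappa> \<in> \<real>\<^sub>\<ge>\<^sub>0" using \<phi> by (simp add: state_on_def \<kappa>_def \<phi>_def)
  then obtain k where k: "\<kappa> = of_real k" "k \<ge> 0" by (auto elim: nonneg_Reals_cases)
  have expand: "\<phi> (star (1 + c *\<^sub>C y) * x * (1 + c *\<^sub>C y)) =
      \<phi> x + c * \<phi> (x * y) + cnj c * \<phi> (star y * x) + (cnj c * c) * \<phi> (star y * x * y)" for c x
  proof -
    have "star (1 + c *\<^sub>C y) * x * (1 + c *\<^sub>C y)
        = x + c *\<^sub>C (x * y) + cnj c *\<^sub>C (star y * x) + (cnj c * c) *\<^sub>C (star y * x * y)"
      by (simp add: star_add star_scaleC algebra_simps mult_scaleC_left mult_scaleC_right scaleC_scaleC scaleC_add_right)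
    thus ?thesis by (simp add: \<phi>lin)
  qed
  have key: "c * \<kappa> + cnj c * \<phi> (star y * star y) + (cnj c * c) * \<phi> (star y * star y * y) = 0" for c
  proof -
    define n where "n = 1 + (cmod c)\<^sup>2 * k"
    have n: "n > 0" using k(2) by (simp add: n_def add_pos_nonneg)
    have n': "of_real n = 1 + cnj c * c * \<kappa>" by (simp add: n_def k complex_norm_square mult.commute del: of_real_power)
    define g where "g x = of_real (1 / n) * \<phi> (star (1 + c *\<^sub>C y) * x * (1 + c *\<^sub>C y))" for x
    have gD: "g d = \<rho> d" if d: "d \<in> D" for d
    proof -
      have "\<phi> (d * y) = 0" "\<phi> (star y * d) = 0" using d Ey by (simp_all add: \<phi>_def E_left E_right lin)
      moreover have "\<phi> (star y * d * y) = \<rho> d * \<kappa>" "\<phi> d = \<rho> d" using \<kappa> d by (simp_all add: \<phi>_def)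
      ultimately have "\<phi> (star (1 + c *\<^sub>C y) * d * (1 + c *\<^sub>C y)) = of_real n * \<rho> d"
        unfolding expand n' by (simp add: algebra_simps)
      thus ?thesis using n by (simp add: g_def)
    qed
    have "state_on UNIV g"
      unfolding state_on_def clinear_on_def
    proof (intro conjI ballI allI)
      show "g 1 = 1" using gD[OF one] by (simp add: lin)
      fix x z :: 'a and t
      show "g (x + z) = g x + g z" by (simp add: g_def distrib_left distrib_right \<phi>lin)
      show "g (t *\<^sub>C x) = t *\<^sub>C g x"
        by (simp only: g_def mult_scaleC_left mult_scaleC_right \<phi>lin scaleC_complex_def mult.left_commute)
      have "star (1 + c *\<^sub>C y) * (star x * x) * (1 + c *\<^sub>C y) = star (x * (1 + c *\<^sub>C y)) * (x * (1 + c *\<^sub>C y))"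
        by (simp only: star_mult mult.assoc)
      moreover have "\<phi> (star w * w) \<in> \<real>\<^sub>\<ge>\<^sub>0" for w using \<phi> by (simp add: state_on_def)
      ultimately show "g (star x * x) \<in> \<real>\<^sub>\<ge>\<^sub>0" unfolding g_def using n by (simp only:) (intro nonneg_Reals_mult_I; simp)
    qed
    hence "g (star y) = 0" using extension_eq[OF \<rho> _ gD, of "star y"] Ey by (simp add: lin)
    hence "\<phi> (star (1 + c *\<^sub>C y) * star y * (1 + c *\<^sub>C y)) = 0" using n by (simp add: g_def)
    thus ?thesis unfolding expand using Ey by (simp add: \<phi>_def \<kappa>_def lin)
  qed
  \<comment> \<open>\<open>c = 1, -1, \<i>, -\<i>\<close> isolate the coefficient of \<open>c\<close>\<close>
  define P R where "P = \<phi> (star y * star y)" and "R = \<phi> (star y * star y * y)"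
  have k: "\<kappa> + P + R = 0" "- \<kappa> - P + R = 0" "\<i> * \<kappa> - \<i> * P + R = 0" "\<i> * P - \<i> * \<kappa> + R = 0"
    using key[of 1] key[of "-1"] key[of \<i>] key[of "-\<i>"] by (simp_all add: P_def R_def)
  have "4 * \<kappa> = (\<kappa> + P + R) - (- \<kappa> - P + R)
      - \<i> * ((\<i> * \<kappa> - \<i> * P + R) - (\<i> * P - \<i> * \<kappa> + R))"
    by (simp add: algebra_simps)
  hence "\<kappa> = 0" unfolding k by simp
  thus ?thesis by (simp add: \<kappa>_def y_def e_def)
qed

lemma normalizers_star_mult:
  assumes "v \<in> normalizers D" "w \<in> normalizers D"
  shows "star v * w \<in> normalizers D"
  unfolding normalizers_def
proof (intro CollectI ballI)
  fix d assume d: "d \<in> D"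
  have "star v * w * d * star (star v * w) = star v * (w * d * star w) * v"
    "star (star v * w) * d * (star v * w) = star w * (v * d * star v) * w"
    by (simp_all add: star_mult star_star mult.assoc)
  thus "star v * w * d * star (star v * w) \<in> D \<and> star (star v * w) * d * (star v * w) \<in> D"
    using normalizer_mem[OF assms(1)] normalizer_mem[OF assms(2)] d by simp
qed

text \<open>With \<open>u = star v * w\<close> the vector \<open>v * u = (v * star v) * w\<close> is a nonzero multiple of
\<open>w\<close>, because \<open>w\<close> is an eigenvector, and a multiple of \<open>v\<close>, because \<open>u\<close>
equals the scalar \<open>\<rho> (E u)\<close> as a vector.\<close>

lemma orthogonality_transfer:
  assumes v: "v \<in> normalizers D" and w: "w \<in> normalizers D" and \<rho>: "character \<rho>"
    and nz: "\<rho> (E (star v * w)) \<noteq> 0" and z: "\<rho> (E (star v * b)) = 0"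
  shows "\<rho> (E (star w * b)) = 0"
proof -
  have st: "state_on D \<rho>" using \<rho> by (simp add: character_def)
  define u where "u = star v * w"
  have u: "u \<in> normalizers D" unfolding u_def by (intro normalizers_star_mult v w)
  define \<phi> where "\<phi> x = \<rho> (E x)" for x
  have \<phi>: "state_on UNIV \<phi>" unfolding \<phi>_def by (rule state_E[OF st])
  have null: "\<phi> (star (u - E u) * (u - E u)) = 0"
    unfolding \<phi>_def using nz by (intro fixing_normalizer u \<rho>) (simp add: u_def)
  have "star u * (star v * b) = star (u - E u) * (star v * b) + star (E u) * (star v * b)"
    by (simp add: star_diff algebra_simps)
  hence "\<phi> (star u * (star v * b)) = \<phi> (star (u - E u) * (star v * b)) + \<phi> (star (E u) * (star v * b))"
    by (simp add: whole.state_clinear[OF \<phi>])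
  also have "\<phi> (star (u - E u) * (star v * b)) = 0" using whole.state_null(1)[OF \<phi> _ null] by simp
  also have "\<phi> (star (E u) * (star v * b)) = 0"
    using \<rho> z by (simp add: \<phi>_def E_left character_def)
  finally have "\<rho> (E (star w * (v * star v) * b)) = 0" by (simp add: \<phi>_def u_def star_mult star_star mult.assoc)
  with normalizer_eigen[OF w normalizer_mem(4)[OF v] \<rho>, of b]
  have "\<rho> (star u * u) * \<rho> (E (star w * b)) = 0" by (simp add: u_def star_mult star_star mult.assoc)
  moreover have "\<rho> (star u * u) \<noteq> 0"
  proof
    assume "\<rho> (star u * u) = 0"
    hence "\<phi> (star u * u) = 0" using normalizer_mem(3)[OF u] by (simp add: \<phi>_def)
    from whole.state_null(2)[OF \<phi> _ this, of 1] have "\<phi> u = 0" by simp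
    thus False using nz by (simp add: \<phi>_def u_def)
  qed
  ultimately show ?thesis by simp
qed

section \<open>Multiplicativity on triangular subalgebras\<close>

text \<open>Split the normalizers into those orthogonal to \<open>b\<close> and the others. By
\<open>orthogonality_transfer\<close> the two classes are orthogonal to each other, and by
\<open>triangular_coefficients\<close> the second is orthogonal to \<open>star a\<close>. When \<open>s0 + s1\<close>
approximates \<open>b\<close> accordingly, \<open>s0\<close> is orthogonal to \<open>b - s1\<close>, so \<open>s1\<close>
alone approximates \<open>b\<close> at least as well in the seminorm of \<open>\<phi>\<close>; and \<open>\<langle>star a,
b\<rangle> = \<langle>star a, b - s1\<rangle>\<close>.\<close>

lemma E_mult_eq_0:
  assumes dense: "closure (cspan (normalizers D)) = UNIV"
    and A: "triangular_subalgebra D A" and a: "a \<in> A" and b: "b \<in> A" "E b = 0"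
  shows "E (a * b) = 0"
proof (rule characters_separate[OF E_mem])
  fix \<rho> assume \<rho>: "character \<rho>"
  have st: "state_on D \<rho>" using \<rho> by (simp add: character_def)
  define \<phi> where "\<phi> x = \<rho> (E x)" for x
  have \<phi>: "state_on UNIV \<phi>" unfolding \<phi>_def by (rule state_E[OF st])
  note \<phi>lin = whole.state_clinear[OF \<phi>, simplified] and \<phi>star = whole.state_star[OF \<phi>, simplified]
  define N0 where "N0 = {v\<in>normalizers D. \<phi> (star v * b) = 0}"
  define N1 where "N1 = {v\<in>normalizers D. \<phi> (star v * b) \<noteq> 0}"
  have span0: "\<phi> (star s * z) = 0" if "s \<in> cspan S" "\<And>v. v \<in> S \<Longrightarrow> \<phi> (star v * z) = 0" for s z S
    using that(1) by (induction rule: complex_vector.span_induct_alt)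
      (auto simp: star_add star_scaleC distrib_right mult_scaleC_left \<phi>lin that(2))
  have "cmod (\<phi> (a * b)) \<le> norm a * e" if e: "e > 0" for e
  proof -
    obtain s where s: "s \<in> cspan (normalizers D)" "norm (b - s) < e"
      using dense e closure_approachable[of b "cspan (normalizers D)"] by (auto simp: dist_norm norm_minus_commute)
    have "normalizers D = N0 \<union> N1" by (auto simp: N0_def N1_def)
    with s(1) obtain s0 s1 where s01: "s = s0 + s1" "s0 \<in> cspan N0" "s1 \<in> cspan N1"
      by (auto simp: complex_vector.span_Un)
    have 1: "\<phi> (star s0 * b) = 0" using s01(2) by (rule span0) (simp add: N0_def)
    have "\<phi> (star s1 * s0) = 0"
    proof (rule span0[OF s01(3)])
      fix w assume w: "w \<in> N1"
      have "\<phi> (star s0 * w) = 0"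
      proof (rule span0[OF s01(2)])
        fix v assume "v \<in> N0"
        thus "\<phi> (star v * w) = 0" using w orthogonality_transfer[OF _ _ \<rho>, of v w b]
          by (auto simp: N0_def N1_def \<phi>_def)
      qed
      thus "\<phi> (star w * s0) = 0" using \<phi>star[of "star s0 * w"] by (simp add: star_mult star_star)
    qed
    hence 2: "\<phi> (star s0 * s1) = 0" using \<phi>star[of "star s1 * s0"] by (simp add: star_mult star_star)
    have "\<phi> (star s1 * star a) = 0"
    proof (rule span0[OF s01(3)])
      fix w assume "w \<in> N1"
      hence "\<phi> (a * w) = 0" using triangular_coefficients[OF A a b _ \<rho>, of w] by (auto simp: N1_def \<phi>_def)
      thus "\<phi> (star w * star a) = 0" using \<phi>star[of "a * w"] by (simp add: star_mult)
    qed
    hence 3: "\<phi> (a * s1) = 0" using \<phi>star[of "a * s1"] by (simp add: star_mult)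
    define z where "z = b - s1"
    have s0z: "\<phi> (star s0 * z) = 0" using 1 2 by (simp add: z_def right_diff_distrib \<phi>lin)
    hence zs0: "\<phi> (star z * s0) = 0" using \<phi>star[of "star s0 * z"] by (simp add: star_mult star_star)
    have "star (b - s) * (b - s) = star z * z - star z * s0 - star s0 * z + star s0 * s0"
      by (simp add: z_def s01(1) algebra_simps star_diff star_add)
    hence "\<phi> (star (b - s) * (b - s)) = \<phi> (star z * z) + \<phi> (star s0 * s0)" by (simp add: \<phi>lin s0z zs0)
    moreover have nn: "0 \<le> Re (\<phi> (star x * x))" for x
      using \<phi> by (simp add: state_on_def complex_nonneg_Reals_iff)
    ultimately have "Re (\<phi> (star z * z)) \<le> Re (\<phi> (star (b - s) * (b - s)))" using nn[of s0] by simp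
    also have "\<dots> \<le> (norm (b - s))\<^sup>2" by (rule state_bound[OF \<phi>])
    also have "\<dots> \<le> e\<^sup>2" using s(2) by (intro power_mono) auto
    finally have z: "Re (\<phi> (star z * z)) \<le> e\<^sup>2" .
    have "(cmod (\<phi> (a * b)))\<^sup>2 = (cmod (\<phi> (star (star a) * z)))\<^sup>2"
      by (simp add: z_def right_diff_distrib \<phi>lin 3 star_star)
    also have "\<dots> \<le> Re (\<phi> (star (star a) * star a)) * Re (\<phi> (star z * z))"
      by (intro whole.state_Cauchy_Schwarz[OF \<phi>]) auto
    also have "\<dots> \<le> (norm a)\<^sup>2 * e\<^sup>2"
      using state_bound[OF \<phi>, of "star a"] z by (intro mult_mono nn) auto
    finally have "(cmod (\<phi> (a * b)))\<^sup>2 \<le> (norm a * e)\<^sup>2" by (simp add: power_mult_distrib)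
    thus ?thesis by (rule power2_le_imp_le) (use e in simp)
  qed
  note bound = this
  have "cmod (\<phi> (a * b)) \<le> 0 + e" if "e > 0" for e
  proof -
    have pos: "0 < norm a + 1" by (simp add: add_nonneg_pos)
    have "cmod (\<phi> (a * b)) \<le> norm a * (e / (norm a + 1))"
      using that pos by (intro bound divide_pos_pos)
    also have "\<dots> = norm a * e / (norm a + 1)" by simp
    also have "\<dots> \<le> e" unfolding pos_divide_le_eq[OF pos] using that by (simp add: distrib_left)
    finally show ?thesis by simp
  qed
  hence "cmod (\<phi> (a * b)) \<le> 0" by (rule field_le_epsilon)
  thus "\<rho> (E (a * b)) = 0" by (simp add: \<phi>_def)
qed

end

theorem theorem5p10:
  fixes D A :: "'a :: cstar_algebra set" and E :: "'a \<Rightarrow> 'a"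
  assumes "cstar_diagonal D"
    and "conditional_expectation D E"
    and "triangular_subalgebra D A"
  shows "algebra_hom_on A E \<and> E ` A = D"
proof -
  have D: "1 \<in> D" "abelian_cstar_subalgebra D" "extension_property D"
    and dense: "closure (cspan (normalizers D)) = UNIV"
    using assms(1) by (auto simp: cstar_diagonal_def maximal_abelian_cstar_subalgebra_def)
  interpret expectation_with_extension_property D E
    using D assms(2) by unfold_locales (auto simp: abelian_cstar_subalgebra_def extension_property_def)
  have A: "D \<subseteq> A" "\<And>x y. x \<in> A \<Longrightarrow> y \<in> A \<Longrightarrow> x - y \<in> A"
    using assms(3) by (auto simp: triangular_subalgebra_def closed_subalgebra_def complex_vector.subspace_diff)
  have "E (a * b) = E a * E b" if "a \<in> A" "b \<in> A" for a b
  proof -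
    have "E (a * (b - E b)) = 0"
      using that A by (intro E_mult_eq_0[OF dense assms(3)]) (auto simp: E_diff)
    thus ?thesis by (simp add: right_diff_distrib E_diff E_right)
  qed
  hence "algebra_hom_on A E"
    by (auto simp: algebra_hom_on_def clinear_on_def E_add E_scaleC)
  moreover have "E ` A = D" using A(1) E_D by force
  ultimately show ?thesis ..
qed

end
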